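(* Let $k$ be a field, $A=kQ_A/I_A$ a finite-dimensional monomial algebra with vertices $e_1,\dots,e_n$, and $B$ the algebra obtained by gluing the distinct non-isolated vertices $e_1,e_n$. Assume that for every loop $\alpha$ at $e_1$ or $e_n$ with $\alpha^m\in Z_A$ ($m\ge2$), $\mathrm{char}(k)\nmid m$. Let $Y=\psi_1(\mathrm{Im}\,\delta^0_A)\oplus Z_{sp}$. Then $Y$ is a subspace of $\mathrm{Ker}\,\delta^1_B$ and there is an exact commutative diagram whose rows are $0\to Z_{sp}\xrightarrow{\tilde\iota_B} Z_{spp}\to\mathrm{Coker}(\varphi)\to0$, $\;0\to Y\xrightarrow{\iota_B}\mathrm{Ker}\,\delta^1_B\to\mathrm{Ker}\,\delta^1_B/Y\to0$, $\;0\to\mathrm{Im}\,\delta^0_A\xrightarrow{\iota_A}\mathrm{Ker}\,\delta^1_A\to\mathrm{HH}^1(A)\to0$, and whose columns are the short exact sequences $0\to\mathrm{Im}\,\delta^0_A\xrightarrow{\psi_1|}Y\xrightarrow{\pi^0}Z_{sp}\to0$, $0\to\mathrm{Ker}\,\delta^1_A\xrightarrow{\psi_1}\mathrm{Ker}\,\delta^1_B\xrightarrow{\pi^1}Z_{spp}\to0$, $0\to\mathrm{HH}^1(A)\xrightarrow{\varphi}\mathrm{Ker}\,\delta^1_B/Y\xrightarrow{\pi}\mathrm{Coker}(\varphi)\to0$; here $\pi^0,\pi^1$ are canonical projections, $\iota_A,\iota_B$ canonical inclusions, $\varphi$ is the injective map induced by $\psi_1$ and $\pi$ the surjection induced by $\pi^1$.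 Moreover $Y=\mathrm{Im}\,\delta^0_B$ if $e_1,e_n$ lie in different blocks of $A$, and $Y$ contains $\mathrm{Im}\,\delta^0_B$ as a subspace of codimension $1$ if $e_1,e_n$ lie in the same block. In particular, if $Z_{spp}=Z_{sp}$, then $Y$ is a Lie ideal of $\mathrm{Ker}\,\delta^1_B$ and there is a Lie algebra epimorphism $\mathrm{HH}^1(B)\to\mathrm{Ker}\,\delta^1_B/Y\cong\mathrm{HH}^1(A)$ with kernel $I:=Y/\mathrm{Im}\,\delta^0_B$, where $I=0$ if $e_1,e_n$ are in different blocks and $\dim_kI=1$ if they are in the same block.
   Context: Monomial algebra: $A=kQ_A/I_A$, $Q_A$ finite quiver, $I_A$ admissible ideal generated by a minimal set $Z_A$ of paths of length $\ge2$. $\mathcal B_A$: paths of $Q_A$ (including trivial ones) containing no element of $Z_A$ as a subpath; a basis of $A$. Gluing: $B\subseteq A$ is generated by $f_1=e_1+e_n$, $f_i=e_i$ ($2\le i\le n-1$) and all arrows; $B\cong kQ_B/I_B$ where $Q_B$ is $Q_A$ with $e_1,e_n$ identified to $f_1$ (arrow $\alpha\mapsto\alpha^*$), and $I_B$ is generated by $Z_B=\{r^*:r\in Z_A\}\cup\{b^*c^*: b,c\text{ arrows},\ t(c),s(b)\in\{e_1,e_n\},\ t(c)\ne s(b)\}$. For a path $p=a_m\cdots a_1$, $p^*=a_m^*\cdots a_1^*$; $e_i^*=f_i$, $e_1^*=e_n^*=f_1$. $\mathcal B_B$ is the analogous basis of $B$. For paths sets $X,Y$, $k(X\|Y)$ has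 basis the pairs $x\|y$ of parallel paths (same source and target). For monomial $\Lambda=kQ/\langle Z\rangle$ with basis paths $\mathcal B$: $\delta^0(e\|\gamma)=\sum_{s(a)=e,\,a\gamma\in\mathcal B}a\|a\gamma-\sum_{t(a)=e,\,\gamma a\in\mathcal B}a\|\gamma a$ from $k(Q_0\|\mathcal B)$ to $k(Q_1\|\mathcal B)$; $\delta^1(a\|\gamma)=\sum_{r\in Z}r\|r^{a\|\gamma}$ into $k(Z\|\mathcal B)$, where $u^{a\|\gamma}$ is the sum over occurrences of $a$ in $u$ of the path obtained by replacing that occurrence by $\gamma$, keeping only paths in $\mathcal B$. $\mathrm{Ker}\,\delta^1$ is a Lie algebra with $[a\|\gamma,b\|\epsilon]=b\|\epsilon^{a\|\gamma}-a\|\gamma^{b\|\epsilon}$, $\mathrm{Im}\,\delta^0$ is a Lie ideal and $\mathrm{HH}^1(\Lambda)\cong\mathrm{Ker}\,\delta^1/\mathrm{Im}\,\delta^0$ as Lie algebras. $\delta^i_A,\delta^i_B$ denote these maps for $A,B$. $\psi_1:k((Q_A)_1\|\mathcal B_A)\to k((Q_B)_1\|\mathcal B_B)$, $a\|p\mapsto a^*\|p^*$. A special path is a $p\in\mathcal B_A$ from $e_1$ to $e_n$ or from $e_n$ to $e_1$ with $\delta^0_B(f_1\|p^* )\neq0$ (equivalently $ap\notin I_A$ or $pa\notin I_A$ for some arrow $a$); $Z_{sp}$ is the span of the $\delta^0_B(f_1\|p^* )$ over special paths $p$. A special pair is $(\alpha,p)$, $\alpha$ an arrow starting or ending at $e_1$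 or $e_n$, $p\in\mathcal B_A$, $\alpha^*\|p^*$ in $Q_B$ but $\alpha$ not parallel to $p$ in $Q_A$; $Z_{spp}$ is the intersection of $\mathrm{Ker}\,\delta^1_B$ with the span of the $\alpha^*\|p^*$ over special pairs. *)

theory Defs
  imports Main "HOL-Library.Sublist"
begin

section \<open>Quivers with monomial relations\<close>

text \<open>A finite quiver with a set of monomial relations.  A path is a pair (v, as):
  v is its source vertex and as is the list of its arrows in order of traversal, i.e.
  the path a_m ... a_1 (a_1 first) is represented by (s(a_1), [a_1, ..., a_m]);
  a trivial path e_v is (v, []).  A relation (a path of length at least 2) is
  represented by its arrow list.\<close>

record ('v,'a) mon =
  Vs :: "'v set"
  Es :: "'a set"
  sr :: "'a \<Rightarrow> 'v"
  tg :: "'a \<Rightarrow> 'v"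
  Zs :: "'a list set"

type_synonym ('v,'a) path = "'v \<times> 'a list"
type_synonym ('v,'a) ppair = "('v,'a) path \<times> ('v,'a) path"

fun chain :: "('a \<Rightarrow> 'v) \<Rightarrow> ('a \<Rightarrow> 'v) \<Rightarrow> 'v \<Rightarrow> 'a list \<Rightarrow> bool" where
  "chain s t v [] = True"
| "chain s t v (a # as) = (s a = v \<and> chain s t (t a) as)"

definition paths :: "('v,'a) mon \<Rightarrow> ('v,'a) path set" where
  "paths L = {(v, as). v \<in> Vs L \<and> set as \<subseteq> Es L \<and> chain (sr L) (tg L) v as}"

definition ptgt :: "('v,'a) mon \<Rightarrow> ('v,'a) path \<Rightarrow> 'v" where
  "ptgt L p = (if snd p = [] then fst p else tg L (last (snd p)))"

definition parallel :: "('v,'a) mon \<Rightarrow> ('v,'a) path \<Rightarrow> ('v,'a) path \<Rightarrow> bool" where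
  "parallel L p q \<longleftrightarrow> fst p = fst q \<and> ptgt L p = ptgt L q"

text \<open>The basis of the monomial algebra: paths containing no relation as a subpath.\<close>
definition basis :: "('v,'a) mon \<Rightarrow> ('v,'a) path set" where
  "basis L = {p \<in> paths L. \<forall>r \<in> Zs L. \<not> sublist r (snd p)}"

definition vpaths :: "('v,'a) mon \<Rightarrow> ('v,'a) path set" where
  "vpaths L = (\<lambda>v. (v, [])) ` Vs L"

definition apath :: "('v,'a) mon \<Rightarrow> 'a \<Rightarrow> ('v,'a) path" where
  "apath L a = (sr L a, [a])"

definition apaths :: "('v,'a) mon \<Rightarrow> ('v,'a) path set" where
  "apaths L = apath L ` Es L"

definition rpaths :: "('v,'a) mon \<Rightarrow> ('v,'a) path set" where
  "rpaths L = (\<lambda>r. (sr L (hd r), r)) ` Zs L"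

text \<open>Basis of k(X||Y): pairs of parallel paths.\<close>
definition par :: "('v,'a) mon \<Rightarrow> ('v,'a) path set \<Rightarrow> ('v,'a) path set \<Rightarrow> ('v,'a) ppair set" where
  "par L X Y = {(x, y). x \<in> X \<and> y \<in> Y \<and> parallel L x y}"

section \<open>Free vector spaces as finitely supported coefficient functions\<close>

definition fspace :: "'q set \<Rightarrow> ('q \<Rightarrow> 'k::zero) set" where
  "fspace S = {x. \<forall>q. x q \<noteq> 0 \<longrightarrow> q \<in> S}"

definition bv :: "'q \<Rightarrow> ('q \<Rightarrow> 'k::{zero,one})" where
  "bv q = (\<lambda>q'. if q' = q then 1 else 0)"

definition linext :: "'q set \<Rightarrow> ('q \<Rightarrow> 'r \<Rightarrow> 'k::comm_ring_1) \<Rightarrow> ('q \<Rightarrow> 'k) \<Rightarrow> ('r \<Rightarrow> 'k)" where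
  "linext S b x = (\<lambda>r. \<Sum>u\<in>S. x u * b u r)"

definition fspan :: "('q \<Rightarrow> 'k::comm_ring_1) set \<Rightarrow> ('q \<Rightarrow> 'k) set" where
  "fspan S = {x. \<exists>F c. finite F \<and> F \<subseteq> S \<and> x = (\<lambda>q. \<Sum>v\<in>F. c v * v q)}"

definition fsubsp :: "('q \<Rightarrow> 'k::comm_ring_1) set \<Rightarrow> bool" where
  "fsubsp W \<longleftrightarrow> (\<lambda>_. 0) \<in> W \<and> (\<forall>x\<in>W. \<forall>y\<in>W. (\<lambda>q. x q + y q) \<in> W)
     \<and> (\<forall>c x. x \<in> W \<longrightarrow> (\<lambda>q. c * x q) \<in> W)"

section \<open>The maps delta^0, delta^1 and the Lie bracket\<close>

text \<open>delta^0(e||g) = sum_{s(a)=e, a g in B} a||a g - sum_{t(a)=e, g a in B} a||g a.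
  Here "a g" (g first, then a) is (fst g, snd g @ [a]) and "g a" is (s a, a # snd g).\<close>
definition d0b :: "('v,'a) mon \<Rightarrow> ('v,'a) ppair \<Rightarrow> ('v,'a) ppair \<Rightarrow> 'k::comm_ring_1" where
  "d0b L eg q =
     (if \<exists>a\<in>Es L. sr L a = fst (fst eg) \<and> (fst (snd eg), snd (snd eg) @ [a]) \<in> basis L
            \<and> q = (apath L a, (fst (snd eg), snd (snd eg) @ [a])) then 1 else 0)
   - (if \<exists>a\<in>Es L. tg L a = fst (fst eg) \<and> (sr L a, a # snd (snd eg)) \<in> basis L
            \<and> q = (apath L a, (sr L a, a # snd (snd eg))) then 1 else 0)"

definition d0 :: "('v,'a) mon \<Rightarrow> (('v,'a) ppair \<Rightarrow> 'k::comm_ring_1) \<Rightarrow> (('v,'a) ppair \<Rightarrow> 'k)" where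
  "d0 L = linext (par L (vpaths L) (basis L)) (d0b L)"

text \<open>Number of occurrences of the arrow a in the path u whose replacement by the path g
  yields the path p.\<close>
definition occ :: "'a \<Rightarrow> ('v,'a) path \<Rightarrow> ('v,'a) path \<Rightarrow> ('v,'a) path \<Rightarrow> nat" where
  "occ a g u p = card {i. i < length (snd u) \<and> snd u ! i = a
       \<and> p = (fst u, take i (snd u) @ snd g @ drop (Suc i) (snd u))}"

text \<open>Coefficient of the path p in u^(a||g) (only basis paths are kept).\<close>
definition substc :: "('v,'a) mon \<Rightarrow> ('v,'a) ppair \<Rightarrow> ('v,'a) path \<Rightarrow> ('v,'a) path \<Rightarrow> 'k::comm_ring_1" where
  "substc L ag u p = (if p \<in> basis L then of_nat (occ (hd (snd (fst ag))) (snd ag) u p) else 0)"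

text \<open>delta^1(a||g) = sum_{r in Z} r || r^(a||g).\<close>
definition d1b :: "('v,'a) mon \<Rightarrow> ('v,'a) ppair \<Rightarrow> ('v,'a) ppair \<Rightarrow> 'k::comm_ring_1" where
  "d1b L ag q = (if fst q \<in> rpaths L then substc L ag (fst q) (snd q) else 0)"

definition d1 :: "('v,'a) mon \<Rightarrow> (('v,'a) ppair \<Rightarrow> 'k::comm_ring_1) \<Rightarrow> (('v,'a) ppair \<Rightarrow> 'k)" where
  "d1 L = linext (par L (apaths L) (basis L)) (d1b L)"

definition im0 :: "('v,'a) mon \<Rightarrow> (('v,'a) ppair \<Rightarrow> 'k::comm_ring_1) set" where
  "im0 L = d0 L ` fspace (par L (vpaths L) (basis L))"

definition ker1 :: "('v,'a) mon \<Rightarrow> (('v,'a) ppair \<Rightarrow> 'k::comm_ring_1) set" where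
  "ker1 L = {x \<in> fspace (par L (apaths L) (basis L)). d1 L x = (\<lambda>_. 0)}"

text \<open>[a||g, b||e] = b||e^(a||g) - a||g^(b||e), extended bilinearly.\<close>
definition lbrb :: "('v,'a) mon \<Rightarrow> ('v,'a) ppair \<Rightarrow> ('v,'a) ppair \<Rightarrow> ('v,'a) ppair \<Rightarrow> 'k::comm_ring_1" where
  "lbrb L ag be q =
     (if fst q = fst be then substc L ag (snd be) (snd q) else 0)
   - (if fst q = fst ag then substc L be (snd ag) (snd q) else 0)"

definition lbr :: "('v,'a) mon \<Rightarrow> (('v,'a) ppair \<Rightarrow> 'k::comm_ring_1) \<Rightarrow> (('v,'a) ppair \<Rightarrow> 'k) \<Rightarrow> (('v,'a) ppair \<Rightarrow> 'k)" where
  "lbr L x y = (\<lambda>q. \<Sum>u\<in>par L (apaths L) (basis L). \<Sum>v\<in>par L (apaths L) (basis L).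
                       x u * y v * lbrb L u v q)"

section \<open>Quotient spaces (as sets of cosets)\<close>

definition coset :: "('q \<Rightarrow> 'k::comm_ring_1) set \<Rightarrow> ('q \<Rightarrow> 'k) \<Rightarrow> ('q \<Rightarrow> 'k) set" where
  "coset W x = {\<lambda>q. x q + y q | y. y \<in> W}"

definition quot :: "('q \<Rightarrow> 'k::comm_ring_1) set \<Rightarrow> ('q \<Rightarrow> 'k) set \<Rightarrow> ('q \<Rightarrow> 'k) set set" where
  "quot V W = coset W ` V"

definition qadd :: "('q \<Rightarrow> 'k::comm_ring_1) set \<Rightarrow> ('q \<Rightarrow> 'k) set \<Rightarrow> ('q \<Rightarrow> 'k) set" where
  "qadd X Z = {\<lambda>q. x q + z q | x z. x \<in> X \<and> z \<in> Z}"

definition qscale :: "('q \<Rightarrow> 'k::comm_ring_1) set \<Rightarrow> 'k \<Rightarrow> ('q \<Rightarrow> 'k) set \<Rightarrow> ('q \<Rightarrow> 'k) set" where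
  "qscale W c X = {\<lambda>q. c * x q + y q | x y. x \<in> X \<and> y \<in> W}"

text \<open>Bracket of cosets, computed on representatives.\<close>
definition qbr :: "(('q \<Rightarrow> 'k) \<Rightarrow> ('q \<Rightarrow> 'k) \<Rightarrow> ('q \<Rightarrow> 'k)) \<Rightarrow> ('q \<Rightarrow> 'k::comm_ring_1) set
                   \<Rightarrow> ('q \<Rightarrow> 'k) set \<Rightarrow> ('q \<Rightarrow> 'k) set \<Rightarrow> ('q \<Rightarrow> 'k) set" where
  "qbr br W X Z = coset W (br (SOME x. x \<in> X) (SOME z. z \<in> Z))"

text \<open>The map V/W -> V'/W' induced by f, computed on a representative.\<close>
definition induced :: "('q \<Rightarrow> 'k::comm_ring_1) set \<Rightarrow> ('r \<Rightarrow> 'k) set \<Rightarrow> (('q \<Rightarrow> 'k) \<Rightarrow> ('r \<Rightarrow> 'k))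
                      \<Rightarrow> ('q \<Rightarrow> 'k) set \<Rightarrow> ('r \<Rightarrow> 'k) set" where
  "induced W W' f X = coset W' (f (SOME x. x \<in> X))"

text \<open>Short exact sequence 0 -> U -f-> V -g-> W -> 0 (z is the zero of W).\<close>
definition ses :: "'u set \<Rightarrow> 'v set \<Rightarrow> 'w set \<Rightarrow> ('u \<Rightarrow> 'v) \<Rightarrow> ('v \<Rightarrow> 'w) \<Rightarrow> 'w \<Rightarrow> bool" where
  "ses U V W f g z \<longleftrightarrow> (\<forall>x\<in>U. f x \<in> V) \<and> (\<forall>y\<in>V. g y \<in> W) \<and> inj_on f U
      \<and> g ` V = W \<and> {y \<in> V. g y = z} = f ` U"

section \<open>Gluing the vertices u (= e_1) and w (= e_n)\<close>

definition gl :: "'v \<Rightarrow> 'v \<Rightarrow> 'v \<Rightarrow> 'v" where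
  "gl u w v = (if v = w then u else v)"

text \<open>The glued vertex f_1 is represented by u.\<close>
definition glue :: "('v,'a) mon \<Rightarrow> 'v \<Rightarrow> 'v \<Rightarrow> ('v,'a) mon" where
  "glue L u w = \<lparr> Vs = gl u w ` Vs L, Es = Es L, sr = gl u w \<circ> sr L, tg = gl u w \<circ> tg L,
     Zs = Zs L \<union> {[c, b] | b c. b \<in> Es L \<and> c \<in> Es L \<and> tg L c \<in> {u, w} \<and> sr L b \<in> {u, w}
                               \<and> tg L c \<noteq> sr L b} \<rparr>"

text \<open>p |-> p^*.\<close>
definition starp :: "'v \<Rightarrow> 'v \<Rightarrow> ('v,'a) path \<Rightarrow> ('v,'a) path" where
  "starp u w p = (gl u w (fst p), snd p)"

text \<open>psi_1 (a||p) = a^*||p^*, extended linearly.\<close>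
definition psi1 :: "('v,'a) mon \<Rightarrow> 'v \<Rightarrow> 'v \<Rightarrow> (('v,'a) ppair \<Rightarrow> 'k::comm_ring_1) \<Rightarrow> (('v,'a) ppair \<Rightarrow> 'k)" where
  "psi1 L u w x = (\<lambda>q. \<Sum>z\<in>{z \<in> par L (apaths L) (basis L). (starp u w (fst z), starp u w (snd z)) = q}. x z)"

text \<open>Z_sp: span of delta^0_B(f_1 || p^*) over special paths p.\<close>
definition Zsp :: "('v,'a) mon \<Rightarrow> 'v \<Rightarrow> 'v \<Rightarrow> (('v,'a) ppair \<Rightarrow> 'k::comm_ring_1) set" where
  "Zsp L u w = fspan {d0 (glue L u w) (bv ((u, []), starp u w p)) | p.
       p \<in> basis L \<and> ((fst p = u \<and> ptgt L p = w) \<or> (fst p = w \<and> ptgt L p = u))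
       \<and> (d0 (glue L u w) (bv ((u, []), starp u w p)) :: ('v,'a) ppair \<Rightarrow> 'k) \<noteq> (\<lambda>_. 0)}"

text \<open>Special pairs (alpha, p), recorded as the basis elements alpha^*||p^* of B.\<close>
definition spp_pairs :: "('v,'a) mon \<Rightarrow> 'v \<Rightarrow> 'v \<Rightarrow> ('v,'a) ppair set" where
  "spp_pairs L u w = {(apath (glue L u w) al, starp u w p) | al p.
       al \<in> Es L \<and> (sr L al \<in> {u, w} \<or> tg L al \<in> {u, w}) \<and> p \<in> basis L
       \<and> (apath (glue L u w) al, starp u w p) \<in> par (glue L u w) (apaths (glue L u w)) (basis (glue L u w))
       \<and> \<not> parallel L (apath L al) p}"

definition Zspp :: "('v,'a) mon \<Rightarrow> 'v \<Rightarrow> 'v \<Rightarrow> (('v,'a) ppair \<Rightarrow> 'k::comm_ring_1) set" where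
  "Zspp L u w = ker1 (glue L u w) \<inter> fspan (bv ` spp_pairs L u w)"

text \<open>The canonical projections pi^1 : Ker delta^1_B -> Z_spp and pi^0 : Y -> Z_sp
  (projection onto the special-pair coordinates).\<close>
definition pi1 :: "('v,'a) mon \<Rightarrow> 'v \<Rightarrow> 'v \<Rightarrow> (('v,'a) ppair \<Rightarrow> 'k::comm_ring_1) \<Rightarrow> (('v,'a) ppair \<Rightarrow> 'k)" where
  "pi1 L u w x = (\<lambda>q. if q \<in> spp_pairs L u w then x q else 0)"

definition pi0 :: "('v,'a) mon \<Rightarrow> 'v \<Rightarrow> 'v \<Rightarrow> (('v,'a) ppair \<Rightarrow> 'k::comm_ring_1) \<Rightarrow> (('v,'a) ppair \<Rightarrow> 'k)" where
  "pi0 L u w x = (\<lambda>q. if q \<in> spp_pairs L u w then x q else 0)"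

text \<open>Y = psi_1(Im delta^0_A) + Z_sp.\<close>
definition Yspace :: "('v,'a) mon \<Rightarrow> 'v \<Rightarrow> 'v \<Rightarrow> (('v,'a) ppair \<Rightarrow> 'k::comm_ring_1) set" where
  "Yspace L u w = {\<lambda>q. a q + b q | a b. a \<in> psi1 L u w ` im0 L \<and> b \<in> Zsp L u w}"

text \<open>Blocks: the linkage classes of the vertices, e_i ~ e_j when e_j A e_i is nonzero.\<close>
definition same_block :: "('v,'a) mon \<Rightarrow> 'v \<Rightarrow> 'v \<Rightarrow> bool" where
  "same_block L u w \<longleftrightarrow>
     (let R = {(fst p, ptgt L p) | p. p \<in> basis L} in (u, w) \<in> (R \<union> R\<inverse>)\<^sup>*)"

end

theory Submission
  imports Defs HOL.Vector_Spaces "HOL-Library.Function_Algebras"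
begin

text \<open>A path of the glued quiver that avoids the new relations is a path of the original quiver, so
  \<open>A\<close> and \<open>B\<close> have the same nontrivial basis paths.  An element of \<open>k(Q\<^sub>1 || \<B>)\<close> is thus, for both
  algebras, a family of coefficients indexed by arrows and words, and \<open>\<delta>\<^sup>1\<close> and the bracket are
  expressed by the derivation of the free algebra with these coefficients.

  Replacing an arrow of a relation of \<open>A\<close> by a path parallel to it in \<open>A\<close> keeps the end points, and
  replacing it by any other path changes them.  Hence the relations of \<open>A\<close> see the parallel and the
  special coefficients of an element of \<open>Ker \<delta>\<^sup>1\<^sub>B\<close> separately.  The new relations see a parallel
  coefficient only at pairs consisting of a loop and its vertex, where it vanishes by the hypothesis
  on the characteristic.  This gives \<open>Ker \<delta>\<^sup>1\<^sub>B = \<psi>\<^sub>1(Ker \<delta>\<^sup>1\<^sub>A) \<oplus> Z\<^sub>s\<^sub>p\<^sub>p\<close>, and the diagram is formal.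

  Modulo \<open>Im \<delta>\<^sup>0\<^sub>B\<close>, the space \<open>Y\<close> is spanned by \<open>\<psi>\<^sub>1(\<delta>\<^sup>0\<^sub>A(e\<^sub>1 || e\<^sub>1))\<close>.  The coefficients at
  the pairs \<open>a || a\<close> show that this element lies in \<open>Im \<delta>\<^sup>0\<^sub>B\<close> exactly when some function on the
  vertices is constant on the blocks of \<open>A\<close> and takes values differing by 1 at \<open>e\<^sub>1\<close> and \<open>e\<^sub>n\<close>.\<close>

section \<open>Subspaces and quotients of spaces of functions\<close>

text \<open>Makes coefficient functions a vector space in the sense of the library, so that its
  spans, subspaces and linear maps can replace \<open>fspan\<close> and
  \<open>fsubsp\<close>.\<close>

definition scal :: "'k::field \<Rightarrow> ('q \<Rightarrow> 'k) \<Rightarrow> 'q \<Rightarrow> 'k" where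
  "scal c x = (\<lambda>q. c * x q)"

lemma scal_apply [simp]: "scal c x q = c * x q"
  by (simp add: scal_def)

interpretation fn: vector_space scal
  by unfold_locales (auto simp: fun_eq_iff algebra_simps)

abbreviation flinear :: "(('q \<Rightarrow> 'k::field) \<Rightarrow> 'r \<Rightarrow> 'k) \<Rightarrow> bool" where
  "flinear \<equiv> module_hom scal scal"

lemma flinearI:
  assumes "\<And>x y. f (x + y) = f x + f y" and "\<And>c x. f (scal c x) = scal c (f x)"
  shows "flinear f"
  using assms by unfold_locales auto

lemma flinear_image_subset:
  assumes "flinear f" "fn.subspace W" "\<And>x. x \<in> S \<Longrightarrow> f x \<in> W"
  shows "f ` fn.span S \<subseteq> W"
  using assms by (metis fn.span_minimal image_subsetI module_hom.span_image)

lemma sum_fun_apply: "(\<Sum>i\<in>A. f i) q = (\<Sum>i\<in>A. f i q)"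
  for f :: "'i \<Rightarrow> 'q \<Rightarrow> 'k::comm_monoid_add"
  by (induction A rule: infinite_finite_induct) auto

lemma fsubsp_iff: "fsubsp W \<longleftrightarrow> fn.subspace W"
  by (auto simp: fsubsp_def fn.subspace_def zero_fun_def plus_fun_def scal_def)

lemma fspan_eq: "fspan S = fn.span S" for S :: "('q \<Rightarrow> 'k::field) set"
proof -
  have "(\<lambda>q. \<Sum>v\<in>F. c v * v q) = (\<Sum>v\<in>F. scal (c v) v)" for F and c :: "('q \<Rightarrow> 'k) \<Rightarrow> 'k"
    by (simp add: fun_eq_iff sum_fun_apply)
  then show ?thesis
    by (simp add: fspan_def fn.span_explicit conj_ac)
qed

lemma subspace_fspace: "fn.subspace (fspace S)"
  unfolding fn.subspace_def fspace_def
  by (auto, metis add.right_neutral)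

lemma fspace_expand:
  fixes x :: "'q \<Rightarrow> 'k::field"
  assumes "finite S" "x \<in> fspace S"
  shows "x = (\<Sum>s\<in>S. scal (x s) (bv s))"
proof
  fix q
  have "(\<Sum>s\<in>S. scal (x s) (bv s)) q = (\<Sum>s\<in>S. if s = q then x q else 0)"
    unfolding sum_fun_apply by (intro sum.cong) (auto simp: bv_def)
  also have "\<dots> = x q"
    using assms by (auto simp: fspace_def)
  finally show "x q = (\<Sum>s\<in>S. scal (x s) (bv s)) q" by simp
qed

lemma span_bv: "finite S \<Longrightarrow> fn.span (bv ` S) = (fspace S :: ('q \<Rightarrow> 'k::field) set)"
proof (intro antisym subsetI)
  fix x :: "'q \<Rightarrow> 'k" assume "finite S" "x \<in> fspace S"
  then show "x \<in> fn.span (bv ` S)"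
    by (subst fspace_expand) (auto intro!: fn.span_sum fn.span_scale intro: fn.span_base)
next
  fix x :: "'q \<Rightarrow> 'k" assume "x \<in> fn.span (bv ` S)"
  moreover have "bv ` S \<subseteq> (fspace S :: ('q \<Rightarrow> 'k) set)"
    by (auto simp: fspace_def bv_def split: if_splits)
  ultimately show "x \<in> fspace S"
    using fn.span_minimal[OF _ subspace_fspace] by blast
qed

lemma linext_eq:
  "linext S b x = (\<Sum>s\<in>S. scal (x s) (b s))" for b :: "'q \<Rightarrow> 'r \<Rightarrow> 'k::field"
  by (simp add: linext_def fun_eq_iff sum_fun_apply)

lemma linext_bv:
  fixes b :: "'q \<Rightarrow> 'r \<Rightarrow> 'k::field"
  assumes "finite S" "q \<in> S"
  shows "linext S b (bv q) = b q"
proof -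
  have "linext S b (bv q) = (\<Sum>s\<in>S. if s = q then b q else 0)"
    unfolding linext_eq by (intro sum.cong) (auto simp: bv_def)
  then show ?thesis using assms by simp
qed

text \<open>\<open>linext S b\<close> is the linear map that sends \<open>bv s\<close> to
  \<open>b s\<close>, so its image is spanned by these values. Statements about \<open>im0\<close>
  thereby reduce to generators.\<close>

lemma linext_image:
  fixes b :: "'q \<Rightarrow> 'r \<Rightarrow> 'k::field"
  assumes "finite S"
  shows "linext S b ` fspace S = fn.span (b ` S)"
proof (intro antisym subsetI)
  fix y assume "y \<in> linext S b ` fspace S"
  then show "y \<in> fn.span (b ` S)"
    by (auto simp: linext_eq intro!: fn.span_sum fn.span_scale intro: fn.span_base)
next
  fix y assume "y \<in> fn.span (b ` S)"
  moreover have "flinear (linext S b)"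
    by (rule flinearI)
      (auto simp: linext_def fun_eq_iff algebra_simps sum.distrib sum_distrib_left)
  then have "fn.subspace (linext S b ` fspace S)"
    by (rule module_hom.subspace_image[OF _ subspace_fspace])
  moreover have "b ` S \<subseteq> linext S b ` fspace S"
  proof
    fix z assume "z \<in> b ` S"
    then obtain s where "s \<in> S" "z = b s" by auto
    moreover from this have "linext S b (bv s) = b s" using assms by (simp add: linext_bv)
    moreover have "bv s \<in> fspace S" using \<open>s \<in> S\<close> by (auto simp: fspace_def bv_def split: if_splits)
    ultimately show "z \<in> linext S b ` fspace S" by (metis imageI)
  qed
  ultimately show "y \<in> linext S b ` fspace S"
    using fn.span_minimal by blast
qed

section \<open>Cosets and the operations on quotient spaces\<close>

lemma coset_alt: "coset W x = {x + y | y. y \<in> W}"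
  by (simp add: coset_def plus_fun_def)

lemma mem_coset: "z \<in> coset W x \<longleftrightarrow> z - x \<in> W"
proof
  assume "z - x \<in> W"
  moreover have "z = x + (z - x)" by simp
  ultimately show "z \<in> coset W x" unfolding coset_alt by blast
qed (auto simp: coset_alt)

lemma coset_eq_iff:
  assumes W: "fn.subspace W"
  shows "coset W x = coset W y \<longleftrightarrow> x - y \<in> W"
proof
  assume "coset W x = coset W y"
  moreover have "x \<in> coset W x" using fn.subspace_0[OF W] by (simp add: mem_coset)
  ultimately show "x - y \<in> W" by (simp add: mem_coset)
next
  assume xy: "x - y \<in> W"
  have "z - x \<in> W \<longleftrightarrow> z - y \<in> W" for z
  proof -
    have "z - y = (z - x) + (x - y)" "z - x = (z - y) - (x - y)" by simp_all
    then show ?thesis using fn.subspace_add[OF W] fn.subspace_diff[OF W] xy by metis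
  qed
  then show "coset W x = coset W y" by (auto simp: mem_coset)
qed

lemma coset_0 [simp]: "coset W 0 = W"
  by (simp add: coset_alt)

lemma coset_eq_self_iff: "fn.subspace W \<Longrightarrow> coset W x = W \<longleftrightarrow> x \<in> W"
  using coset_eq_iff[of W x 0] by simp

text \<open>The constants \<open>induced\<close> and \<open>qbr\<close> work with a representative
  chosen by \<open>SOME\<close>; all that is known of it is that it differs from a given
  representative by an element of \<open>W\<close>.\<close>

lemma some_coset:
  assumes "fn.subspace W"
  obtains y where "y \<in> W" "(SOME z. z \<in> coset W x) = x + y"
proof -
  have "x \<in> coset W x" using fn.subspace_0[OF assms] by (simp add: mem_coset)
  then have "(SOME z. z \<in> coset W x) \<in> coset W x"
    by (rule someI[where P = "\<lambda>z. z \<in> coset W x"])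
  then show thesis using that by (auto simp: coset_alt)
qed

lemma mem_qadd: "z \<in> qadd X Y \<longleftrightarrow> (\<exists>x\<in>X. \<exists>y\<in>Y. z = x + y)"
  by (auto simp: qadd_def plus_fun_def)

lemma qadd_coset:
  assumes W: "fn.subspace W"
  shows "qadd (coset W x) (coset W y) = coset W (x + y)"
proof (intro set_eqI iffI)
  fix z assume "z \<in> qadd (coset W x) (coset W y)"
  then obtain a b where "a - x \<in> W" "b - y \<in> W" "z = a + b"
    by (auto simp: mem_qadd mem_coset)
  moreover from this have "z - (x + y) = (a - x) + (b - y)" by simp
  ultimately show "z \<in> coset W (x + y)"
    using fn.subspace_add[OF W] by (simp only: mem_coset)
next
  fix z assume z: "z \<in> coset W (x + y)"
  have "z = (z - y) + y" by simp
  moreover have "z - y \<in> coset W x" "y \<in> coset W y"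
    using z fn.subspace_0[OF W] by (auto simp: mem_coset algebra_simps)
  ultimately show "z \<in> qadd (coset W x) (coset W y)" unfolding mem_qadd by blast
qed

lemma mem_qscale: "z \<in> qscale W c X \<longleftrightarrow> (\<exists>x\<in>X. \<exists>y\<in>W. z = scal c x + y)"
proof -
  have "qscale W c X = {scal c x + y | x y. x \<in> X \<and> y \<in> W}"
    unfolding qscale_def plus_fun_def scal_def by (rule refl)
  then show ?thesis
    by (simp only: mem_Collect_eq Bex_def)
      (intro iffI; elim exE conjE; intro exI conjI; assumption)
qed

text \<open>The summand from \<open>W\<close> in \<open>qscale\<close> matters for
  \<open>c = 0\<close>, where the multiples alone would give the single element 0 instead of the
  coset \<open>W\<close>.\<close>

lemma qscale_coset:
  assumes W: "fn.subspace W"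
  shows "qscale W c (coset W x) = coset W (scal c x)"
proof (intro set_eqI iffI)
  fix z assume "z \<in> qscale W c (coset W x)"
  then obtain a b where "a - x \<in> W" "b \<in> W" "z = scal c a + b"
    by (auto simp: mem_qscale mem_coset)
  moreover from this have "z - scal c x = scal c (a - x) + b"
    by (simp add: fn.scale_right_diff_distrib)
  ultimately show "z \<in> coset W (scal c x)"
    using fn.subspace_add[OF W] fn.subspace_scale[OF W] by (simp only: mem_coset)
next
  fix z assume "z \<in> coset W (scal c x)"
  then have "z - scal c x \<in> W" by (simp add: mem_coset)
  moreover have "z = scal c x + (z - scal c x)" by simp
  moreover have "x \<in> coset W x" using fn.subspace_0[OF W] by (simp add: mem_coset)
  ultimately show "z \<in> qscale W c (coset W x)" unfolding mem_qscale by blast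
qed

lemma induced_coset:
  assumes "flinear f" "fn.subspace W" "fn.subspace W'" "\<And>y. y \<in> W \<Longrightarrow> f y \<in> W'"
  shows "induced W W' f (coset W x) = coset W' (f x)"
proof -
  obtain y where "y \<in> W" "(SOME z. z \<in> coset W x) = x + y"
    using some_coset[OF assms(2)] by blast
  then show ?thesis
    using assms by (simp add: induced_def module_hom.add coset_eq_iff)
qed

lemma quot_self:
  assumes "fn.subspace W"
  shows "quot W W = {W}"
proof -
  have "coset W ` W = (\<lambda>_. W) ` W"
    by (rule image_cong) (simp_all add: coset_eq_self_iff[OF assms])
  then show ?thesis
    using fn.subspace_0[OF assms] by (auto simp: quot_def)
qed

text \<open>The three rows of the diagram are instances of this sequence.\<close>

lemma ses_quot:
  assumes "fn.subspace W" "W \<subseteq> V"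
  shows "ses W V (quot V W) id (coset W) W"
  using assms by (auto simp: ses_def quot_def coset_eq_self_iff)

section \<open>The diagram of short exact sequences\<close>

text \<open>The linear algebra behind the diagram: \<open>pr\<close> kills the image of
  \<open>KA\<close> and fixes \<open>ZSS\<close>, so \<open>KB\<close> is the direct sum of an
  injective image of \<open>KA\<close> and of \<open>ZSS\<close>. The exactness of the columns
  follows from this.\<close>

locale split_diagram =
  fixes KA IA :: "('q \<Rightarrow> 'k::field) set" and KB ZS ZSS :: "('r \<Rightarrow> 'k) set"
    and psi :: "('q \<Rightarrow> 'k) \<Rightarrow> 'r \<Rightarrow> 'k" and pr :: "('r \<Rightarrow> 'k) \<Rightarrow> 'r \<Rightarrow> 'k"
  assumes KA: "fn.subspace KA" and IA: "fn.subspace IA" and KB: "fn.subspace KB"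
    and ZS: "fn.subspace ZS" and ZSS: "fn.subspace ZSS"
    and IA_KA: "IA \<subseteq> KA" and ZS_ZSS: "ZS \<subseteq> ZSS" and ZSS_KB: "ZSS \<subseteq> KB"
    and psi: "flinear psi" and pr: "flinear pr"
    and psi_KB: "x \<in> KA \<Longrightarrow> psi x \<in> KB"
    and psi_inj: "x \<in> KA \<Longrightarrow> psi x = 0 \<Longrightarrow> x = 0"
    and pr_psi: "x \<in> KA \<Longrightarrow> pr (psi x) = 0"
    and pr_ZSS: "z \<in> ZSS \<Longrightarrow> pr z = z"
    and decomp: "y \<in> KB \<Longrightarrow> \<exists>x\<in>KA. \<exists>z\<in>ZSS. y = psi x + z"
begin

definition Y where "Y = {psi a + b | a b. a \<in> IA \<and> b \<in> ZS}"

lemma YI: "a \<in> IA \<Longrightarrow> b \<in> ZS \<Longrightarrow> psi a + b \<in> Y"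
  by (auto simp: Y_def)

lemma YE:
  assumes "y \<in> Y"
  obtains a b where "a \<in> IA" "b \<in> ZS" "y = psi a + b"
  using assms by (auto simp: Y_def)

lemma psi_Y: "a \<in> IA \<Longrightarrow> psi a \<in> Y"
  using YI[of a 0] fn.subspace_0[OF ZS] by simp

lemma ZS_Y: "b \<in> ZS \<Longrightarrow> b \<in> Y"
  using YI[of 0 b] fn.subspace_0[OF IA] by (simp add: module_hom.zero[OF psi])

lemma subspace_Y: "fn.subspace Y"
proof -
  have "Y = {x + y | x y. x \<in> psi ` IA \<and> y \<in> ZS}" by (auto simp: Y_def)
  then show ?thesis
    using fn.subspace_sums[OF module_hom.subspace_image[OF psi IA] ZS] by simp
qed

lemma Y_KB: "Y \<subseteq> KB"
proof
  fix y assume "y \<in> Y"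
  then obtain a b where ab: "a \<in> IA" "b \<in> ZS" "y = psi a + b" by (rule YE)
  then have "psi a \<in> KB" "b \<in> KB" using psi_KB IA_KA ZS_ZSS ZSS_KB by auto
  then show "y \<in> KB" using fn.subspace_add[OF KB] ab(3) by simp
qed

lemma pr_sum: "x \<in> KA \<Longrightarrow> z \<in> ZSS \<Longrightarrow> pr (psi x + z) = z"
  by (simp add: module_hom.add[OF pr] pr_psi pr_ZSS)

lemma pr_Y:
  assumes "y \<in> Y"
  shows "pr y \<in> ZS"
proof -
  obtain a b where ab: "a \<in> IA" "b \<in> ZS" "y = psi a + b" using assms by (rule YE)
  then have "pr y = b" using pr_sum[of a b] IA_KA ZS_ZSS by auto
  then show ?thesis using ab by simp
qed

text \<open>The decomposition is unique: \<open>pr\<close> recovers the second component and the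
  injectivity of \<open>psi\<close> the first. Membership in \<open>Y\<close> can thus be read off
  componentwise.\<close>

lemma sum_mem_Y_iff:
  assumes "x \<in> KA" "z \<in> ZSS"
  shows "psi x + z \<in> Y \<longleftrightarrow> x \<in> IA \<and> z \<in> ZS"
proof
  assume "psi x + z \<in> Y"
  then obtain a b where ab: "a \<in> IA" "b \<in> ZS" "psi x + z = psi a + b" by (rule YE)
  have "a \<in> KA" "b \<in> ZSS" using ab IA_KA ZS_ZSS by auto
  then have "z = b" using ab(3) pr_sum assms by metis
  then have "psi (x - a) = 0" using ab(3) by (simp add: module_hom.diff[OF psi])
  then have "x = a" using psi_inj[of "x - a"] \<open>a \<in> KA\<close> assms(1) fn.subspace_diff[OF KA] by auto
  then show "x \<in> IA \<and> z \<in> ZS" using ab \<open>z = b\<close> by simp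
qed (auto intro: YI)

lemma inj_psi: "inj_on psi KA"
proof (rule inj_onI)
  fix x y assume "x \<in> KA" "y \<in> KA" "psi x = psi y"
  then show "x = y"
    using psi_inj[of "x - y"] fn.subspace_diff[OF KA, of x y] by (simp add: module_hom.diff[OF psi])
qed

abbreviation phi where "phi \<equiv> induced IA Y psi"
abbreviation piq where "piq \<equiv> induced Y ZS pr"

lemma phi_coset: "phi (coset IA x) = coset Y (psi x)"
  by (rule induced_coset[OF psi IA subspace_Y psi_Y])

lemma piq_coset: "piq (coset Y y) = coset ZS (pr y)"
  using induced_coset[where f = pr and W = Y and W' = ZS and x = y] pr subspace_Y ZS pr_Y by simp

lemma ses_Y: "ses IA Y ZS psi pr 0"
proof -
  have "b \<in> pr ` Y" if "b \<in> ZS" for b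
    using ZS_Y[OF that] pr_ZSS[of b] ZS_ZSS that by (metis imageI subsetD)
  then have "pr ` Y = ZS"
    using pr_Y by blast
  moreover have "y \<in> psi ` IA" if y: "y \<in> Y" "pr y = 0" for y
  proof -
    obtain a b where ab: "a \<in> IA" "b \<in> ZS" "y = psi a + b" using y(1) by (rule YE)
    then have "b = 0" using y(2) pr_sum IA_KA ZS_ZSS by (metis subsetD)
    then show ?thesis using ab by simp
  qed
  ultimately show ?thesis
    using psi_Y pr_Y pr_psi IA_KA inj_on_subset[OF inj_psi IA_KA]
    by (auto simp: ses_def)
qed

lemma ses_KB: "ses KA KB ZSS psi pr 0"
proof -
  have "pr y \<in> ZSS" if "y \<in> KB" for y
    using decomp[OF that] pr_sum by auto
  moreover have "z \<in> pr ` KB" if "z \<in> ZSS" for z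
    using image_eqI[of z pr z KB] pr_ZSS[OF that] ZSS_KB that by auto
  moreover have "y \<in> psi ` KA" if y: "y \<in> KB" "pr y = 0" for y
  proof -
    obtain a b where ab: "a \<in> KA" "b \<in> ZSS" "y = psi a + b" using decomp[OF y(1)] by auto
    then have "b = 0" using y(2) pr_sum by metis
    then show ?thesis using ab by simp
  qed
  ultimately show ?thesis
    using psi_KB pr_psi inj_psi by (auto simp: ses_def)
qed

text \<open>\<open>Y\<close> splits along the same decomposition as \<open>KB\<close>, so the
  quotient of \<open>KB\<close> by \<open>Y\<close> is the sum of the quotients of \<open>KA\<close>
  by \<open>IA\<close> and of \<open>ZSS\<close> by \<open>ZS\<close>.\<close>

lemma ses_quotients: "ses (quot KA IA) (quot KB Y) (quot ZSS ZS) phi piq ZS"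
proof -
  have inj: "inj_on phi (quot KA IA)"
  proof (rule inj_onI)
    fix X X' assume "X \<in> quot KA IA" "X' \<in> quot KA IA" and eq: "phi X = phi X'"
    then obtain x x' where x: "x \<in> KA" "x' \<in> KA" "X = coset IA x" "X' = coset IA x'"
      by (auto simp: quot_def)
    then have "psi (x - x') + 0 \<in> Y"
      using eq by (simp add: phi_coset coset_eq_iff[OF subspace_Y] module_hom.diff[OF psi])
    then have "x - x' \<in> IA"
      using x fn.subspace_diff[OF KA] fn.subspace_0[OF ZSS] sum_mem_Y_iff by blast
    then show "X = X'" by (simp add: x coset_eq_iff[OF IA])
  qed
  have ker: "X \<in> phi ` quot KA IA" if "X \<in> quot KB Y" "piq X = ZS" for X
  proof -
    obtain y where y: "y \<in> KB" "X = coset Y y" using \<open>X \<in> quot KB Y\<close> by (auto simp: quot_def)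
    obtain a b where ab: "a \<in> KA" "b \<in> ZSS" "y = psi a + b" using decomp[OF y(1)] by auto
    \<comment> \<open>The component \<open>b\<close> lies in \<open>ZS\<close>, hence in
      \<open>Y\<close>, and so drops out of the coset.\<close>
    then have "b \<in> ZS"
      using \<open>piq X = ZS\<close> y by (simp add: piq_coset coset_eq_self_iff[OF ZS] pr_sum)
    then have "X = phi (coset IA a)"
      using ZS_Y by (simp add: y ab phi_coset coset_eq_iff[OF subspace_Y])
    then show ?thesis using ab by (auto simp: quot_def)
  qed
  have im: "piq (phi X) = ZS" if "X \<in> quot KA IA" for X
    using that by (auto simp: quot_def phi_coset piq_coset pr_psi)
  have surj: "X \<in> piq ` quot KB Y" if X: "X \<in> quot ZSS ZS" for X
  proof -
    obtain z where "z \<in> ZSS" "X = coset ZS z" using X by (auto simp: quot_def)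
    then have "X = piq (coset Y z)" "z \<in> KB" using ZSS_KB by (auto simp: piq_coset pr_ZSS)
    then show ?thesis by (auto simp: quot_def)
  qed
  have map1: "phi X \<in> quot KB Y" if "X \<in> quot KA IA" for X
    using that psi_KB by (auto simp: quot_def phi_coset)
  have map2: "piq X \<in> quot ZSS ZS" if "X \<in> quot KB Y" for X
  proof -
    obtain y where "y \<in> KB" "X = coset Y y" using \<open>X \<in> quot KB Y\<close> by (auto simp: quot_def)
    then show ?thesis using ses_KB by (auto simp: quot_def piq_coset ses_def)
  qed
  have "piq ` quot KB Y = quot ZSS ZS"
    using surj map2 by (intro equalityI subsetI) auto
  moreover have "{X \<in> quot KB Y. piq X = ZS} = phi ` quot KA IA"
    using ker im map1 by (intro equalityI subsetI) auto
  ultimately show ?thesis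
    using inj map1 map2 by (simp add: ses_def)
qed

text \<open>The cokernel is then a single point, so exactness makes every coset an image under
  \<open>phi\<close>.\<close>

lemma bij_phi:
  assumes "ZSS = ZS"
  shows "bij_betw phi (quot KA IA) (quot KB Y)"
proof -
  have "piq X = ZS" if "X \<in> quot KB Y" for X
    using ses_quotients that quot_self[OF ZS] by (auto simp: ses_def assms)
  then have "{X \<in> quot KB Y. piq X = ZS} = quot KB Y" by blast
  then show ?thesis using ses_quotients by (simp add: ses_def bij_betw_def)
qed

lemma phi_qadd:
  assumes "X \<in> quot KA IA" "Z \<in> quot KA IA"
  shows "phi (qadd X Z) = qadd (phi X) (phi Z)"
  using assms
  by (auto simp: quot_def phi_coset qadd_coset[OF IA] qadd_coset[OF subspace_Y] module_hom.add[OF psi])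

lemma phi_qscale:
  assumes "X \<in> quot KA IA"
  shows "phi (qscale IA c X) = qscale Y c (phi X)"
  using assms
  by (auto simp: quot_def phi_coset qscale_coset[OF IA] qscale_coset[OF subspace_Y]
      module_hom.scale[OF psi])

end

section \<open>Brackets on quotients\<close>

text \<open>Changing representatives by elements of an ideal changes the bracket by an element of
  this ideal, so the bracket computed by \<open>qbr\<close> does not depend on the choice.\<close>

lemma qbr_coset:
  assumes W: "fn.subspace W" "W \<subseteq> K" "fn.subspace K"
    and br1: "\<And>y. flinear (br y)" and br2: "\<And>x y. br y x = - br x y"
    and ideal: "\<And>x y. x \<in> K \<Longrightarrow> y \<in> W \<Longrightarrow> br x y \<in> W"
    and x: "x \<in> K" and z: "z \<in> K"
  shows "qbr br W (coset W x) (coset W z) = coset W (br x z)"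
proof -
  obtain a where a: "a \<in> W" "(SOME v. v \<in> coset W x) = x + a" using some_coset[OF W(1)] by blast
  obtain b where b: "b \<in> W" "(SOME v. v \<in> coset W z) = z + b" using some_coset[OF W(1)] by blast
  have "x + a \<in> K" using x a W fn.subspace_add[OF W(3)] by auto
  \<comment> \<open>Linearity is assumed in the second argument; antisymmetry carries it over to the
    first.\<close>
  have "br (x + a) z = - (br z x + br z a)"
    unfolding br2[where x = z and y = "x + a"] by (simp only: module_hom.add[OF br1])
  then have "br (x + a) z = br x z - br z a"
    unfolding br2[where x = x and y = z] by (simp only: minus_add_distrib minus_minus add_uminus_conv_diff)
  then have "br (x + a) (z + b) - br x z = br (x + a) b - br z a"
    by (simp only: module_hom.add[OF br1] diff_add_eq add_diff_cancel_left' diff_diff_eq)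
      (simp only: fun_eq_iff minus_apply plus_fun_apply, simp)
  moreover have "br (x + a) b - br z a \<in> W"
    using ideal \<open>x + a \<in> K\<close> z a b fn.subspace_diff[OF W(1)] by auto
  ultimately show ?thesis
    by (simp add: qbr_def a b coset_eq_iff[OF W(1)])
qed

section \<open>Derivations on words\<close>

text \<open>Left multiplication by the word \<open>x\<close> in the free algebra, acting on formal
  combinations of words given by their coefficients.\<close>

definition left_mult :: "'a list \<Rightarrow> ('a list \<Rightarrow> 'k::zero) \<Rightarrow> 'a list \<Rightarrow> 'k" where
  "left_mult x f p = (if take (length x) p = x then f (drop (length x) p) else 0)"

definition right_mult :: "'a list \<Rightarrow> ('a list \<Rightarrow> 'k::zero) \<Rightarrow> 'a list \<Rightarrow> 'k" where
  "right_mult y f p = (if length y \<le> length p \<and> drop (length p - length y) p = y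
     then f (take (length p - length y) p) else 0)"

lemma left_mult_append [simp]: "left_mult x f (x @ q) = f q"
  by (simp add: left_mult_def)

lemma right_mult_append [simp]: "right_mult y f (q @ y) = f q"
  by (simp add: right_mult_def)

lemma left_mult_eq_0: "(\<And>q. p = x @ q \<Longrightarrow> f q = 0) \<Longrightarrow> left_mult x f p = 0"
  by (simp add: left_mult_def) (metis append_take_drop_id)

lemma right_mult_eq_0: "(\<And>q. p = q @ y \<Longrightarrow> f q = 0) \<Longrightarrow> right_mult y f p = 0"
  by (simp add: right_mult_def) (metis append_take_drop_id)

lemma left_mult_nonzeroE:
  assumes "left_mult x f p \<noteq> 0"
  obtains q where "p = x @ q" "f q \<noteq> 0"
  using assms left_mult_eq_0 by metis

lemma right_mult_nonzeroE:
  assumes "right_mult y f p \<noteq> 0"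
  obtains q where "p = q @ y" "f q \<noteq> 0"
  using assms right_mult_eq_0 by metis

lemma left_mult_Nil [simp]: "left_mult [] f = f"
  by (simp add: left_mult_def fun_eq_iff)

lemma right_mult_Nil [simp]: "right_mult [] f = f"
  by (simp add: right_mult_def fun_eq_iff)

lemma left_mult_left_mult: "left_mult x (left_mult y f) = left_mult (x @ y) f"
proof
  fix p show "left_mult x (left_mult y f) p = left_mult (x @ y) f p"
  proof (cases "\<exists>q. p = x @ y @ q")
    case True
    then obtain q where "p = x @ y @ q" by blast
    then show ?thesis using left_mult_append[of "x @ y" f q] by simp
  next
    case False
    then have "left_mult x (left_mult y f) p = 0" "left_mult (x @ y) f p = 0" by (auto intro!: left_mult_eq_0)
    then show ?thesis by simp
  qed
qed

lemma right_mult_right_mult: "right_mult y (right_mult x f) = right_mult (x @ y) f"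
proof
  fix p show "right_mult y (right_mult x f) p = right_mult (x @ y) f p"
  proof (cases "\<exists>q. p = (q @ x) @ y")
    case True
    then obtain q where p: "p = (q @ x) @ y" by blast
    have "right_mult (x @ y) f p = f q" using right_mult_append[of "x @ y" f q] by (simp add: p)
    moreover have "right_mult y (right_mult x f) p = f q" unfolding p by (simp only: right_mult_append)
    ultimately show ?thesis by simp
  next
    case False
    then have "right_mult y (right_mult x f) p = 0" "right_mult (x @ y) f p = 0" by (auto intro!: right_mult_eq_0)
    then show ?thesis by simp
  qed
qed

lemma left_mult_right_mult: "left_mult x (right_mult y f) = right_mult y (left_mult x f)"
proof
  fix p show "left_mult x (right_mult y f) p = right_mult y (left_mult x f) p"
  proof (cases "\<exists>q. p = x @ q @ y")
    case True
    then obtain q where p: "p = x @ q @ y" by blast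
    have "right_mult y (left_mult x f) p = f q" using right_mult_append[of y "left_mult x f" "x @ q"] by (simp add: p)
    then show ?thesis by (simp add: p)
  next
    case False
    then have "left_mult x (right_mult y f) p = 0" "right_mult y (left_mult x f) p = 0"
      by (auto intro!: right_mult_eq_0 left_mult_eq_0)
    then show ?thesis by simp
  qed
qed

lemma left_mult_add: "left_mult x (f + g) = left_mult x f + left_mult x g" for f g :: "'a list \<Rightarrow> 'k::monoid_add"
  by (simp add: left_mult_def fun_eq_iff)

lemma right_mult_add: "right_mult x (f + g) = right_mult x f + right_mult x g" for f g :: "'a list \<Rightarrow> 'k::monoid_add"
  by (simp add: right_mult_def fun_eq_iff)

lemma left_mult_0 [simp]: "left_mult x 0 = 0" for x :: "'a list"
  by (simp add: left_mult_def fun_eq_iff)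

lemma right_mult_0 [simp]: "right_mult x 0 = 0" for x :: "'a list"
  by (simp add: right_mult_def fun_eq_iff)

text \<open>At most one \<open>g\<close> satisfies \<open>p = g @ y\<close>, so the sum has at most
  one nonzero term. It may run over any finite set that contains this word whenever its coefficient
  is nonzero.\<close>

lemma sum_right_mult:
  assumes "finite C" "\<And>g. p = g @ y \<Longrightarrow> f g \<noteq> 0 \<Longrightarrow> g \<in> C"
  shows "(\<Sum>g\<in>C. f g * (if p = g @ y then 1 else 0)) = (right_mult y f p :: 'k::comm_ring_1)"
proof (cases "\<exists>q. p = q @ y")
  case True
  then obtain q where p: "p = q @ y" by blast
  have "(\<Sum>g\<in>C. f g * (if p = g @ y then 1 else 0)) = (\<Sum>g\<in>C. if g = q then f q else 0)"
    by (intro sum.cong) (auto simp: p)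
  also have "\<dots> = f q" using assms p by auto
  finally show ?thesis by (simp add: p)
next
  case False
  then have "right_mult y f p = 0" by (intro right_mult_eq_0) auto
  then show ?thesis using False by auto
qed

lemma sum_left_mult:
  assumes "finite C" "\<And>g. p = x @ g \<Longrightarrow> f g \<noteq> 0 \<Longrightarrow> g \<in> C"
  shows "(\<Sum>g\<in>C. f g * (if p = x @ g then 1 else 0)) = (left_mult x f p :: 'k::comm_ring_1)"
proof (cases "\<exists>q. p = x @ q")
  case True
  then obtain q where p: "p = x @ q" by blast
  have "(\<Sum>g\<in>C. f g * (if p = x @ g then 1 else 0)) = (\<Sum>g\<in>C. if g = q then f q else 0)"
    by (intro sum.cong) (auto simp: p)
  also have "\<dots> = f q" using assms p by auto
  finally show ?thesis by (simp add: p)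
next
  case False
  then have "left_mult x f p = 0" by (intro left_mult_eq_0) auto
  then show ?thesis using False by auto
qed

text \<open>The value on a word of the derivation of the free algebra on the arrows that sends the
  letter a to the formal sum of the words g with coefficients X a g.\<close>
primrec der :: "('a \<Rightarrow> 'a list \<Rightarrow> 'k::comm_ring_1) \<Rightarrow> 'a list \<Rightarrow> 'a list \<Rightarrow> 'k" where
  "der X [] = 0"
| "der X (a # us) = right_mult us (X a) + left_mult [a] (der X us)"

text \<open>The Leibniz rule: the letter that is replaced lies in \<open>us\<close> or in
  \<open>vs\<close>.\<close>

lemma der_append: "der X (us @ vs) = right_mult vs (der X us) + left_mult us (der X vs)"
proof (induction us)
  case (Cons a us)
  have "der X ((a # us) @ vs) = right_mult (us @ vs) (X a)
      + (left_mult [a] (right_mult vs (der X us)) + left_mult [a] (left_mult us (der X vs)))"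
    by (simp only: append_Cons der.simps Cons.IH left_mult_add)
  also have "\<dots> = right_mult vs (right_mult us (X a)) + right_mult vs (left_mult [a] (der X us))
      + left_mult (a # us) (der X vs)"
    by (simp only: right_mult_right_mult left_mult_right_mult left_mult_left_mult append_Cons append_Nil add.assoc)
  also have "\<dots> = right_mult vs (der X (a # us)) + left_mult (a # us) (der X vs)"
    by (simp only: der.simps right_mult_add)
  finally show ?case .
qed (simp only: der.simps append_Nil right_mult_0 left_mult_Nil add_0_left)

text \<open>By the recursion each word in the support arises by replacing a single letter. The
  arguments on end points rest on this form.\<close>

lemma der_nonzeroE:
  assumes "der X us p \<noteq> 0"
  obtains r1 a r2 g where "us = r1 @ a # r2" "p = r1 @ g @ r2" "X a g \<noteq> 0"
proof -
  have "\<exists>r1 a r2 g. us = r1 @ a # r2 \<and> p = r1 @ g @ r2 \<and> X a g \<noteq> 0"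
    using assms
  proof (induction us arbitrary: p)
    case (Cons b us)
    then consider "right_mult us (X b) p \<noteq> 0" | "left_mult [b] (der X us) p \<noteq> 0" by fastforce
    then show ?case
    proof cases
      case 1
      then obtain g where "p = g @ us" "X b g \<noteq> 0" by (rule right_mult_nonzeroE)
      then show ?thesis by (intro exI[of _ "[]"] exI[of _ b] exI[of _ us] exI[of _ g]) simp
    next
      case 2
      then obtain q where q: "p = [b] @ q" "der X us q \<noteq> 0" by (rule left_mult_nonzeroE)
      then obtain r1 a r2 g where "us = r1 @ a # r2" "q = r1 @ g @ r2" "X a g \<noteq> 0"
        using Cons.IH by blast
      then show ?thesis
        using q by (intro exI[of _ "b # r1"] exI[of _ a] exI[of _ r2] exI[of _ g]) simp
    qed
  qed simp
  then show thesis using that by blast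
qed

lemma der_add: "der (\<lambda>a g. X a g + Y a g) us p = der X us p + der Y us p"
proof (induction us arbitrary: p)
  case (Cons a us)
  have *: "der (\<lambda>a g. X a g + Y a g) us = der X us + der Y us"
    using Cons.IH by (simp add: fun_eq_iff)
  have "(\<lambda>g. X a g + Y a g) = X a + Y a" by (simp add: fun_eq_iff)
  then show ?case by (simp add: * left_mult_add right_mult_add)
qed simp

definition wocc :: "'a \<Rightarrow> 'a list \<Rightarrow> 'a list \<Rightarrow> 'a list \<Rightarrow> nat" where
  "wocc a g h p = card {i. i < length h \<and> h ! i = a \<and> p = take i h @ g @ drop (Suc i) h}"

lemma occ_eq: "occ a g h p = (if fst p = fst h then wocc a (snd g) (snd h) (snd p) else 0)"
  by (cases p) (auto simp: occ_def wocc_def)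

lemma wocc_Nil [simp]: "wocc a g [] p = 0"
  by (simp add: wocc_def)

text \<open>An occurrence is at position 0 or at the successor of a position in the tail; in the
  second case the first letter stays in place. This matches the recursion of
  \<open>der\<close>.\<close>

lemma wocc_Cons:
  "wocc a g (b # h) p = (if a = b \<and> p = g @ h then 1 else 0)
     + (if p \<noteq> [] \<and> hd p = b then wocc a g h (tl p) else 0)"
proof -
  let ?S = "\<lambda>h p. {i. i < length h \<and> h ! i = a \<and> p = take i h @ g @ drop (Suc i) h}"
  let ?T = "if p \<noteq> [] \<and> hd p = b then ?S h (tl p) else {}"
  have "?S (b # h) p = (if a = b \<and> p = g @ h then {0} else {}) \<union> Suc ` ?T"
  proof (intro set_eqI)
    fix i show "i \<in> ?S (b # h) p \<longleftrightarrow> i \<in> (if a = b \<and> p = g @ h then {0} else {}) \<union> Suc ` ?T"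
    proof (cases i)
      case (Suc j)
      have "i \<in> Suc ` ?T \<longleftrightarrow> j \<in> ?T" unfolding Suc by (rule inj_image_mem_iff) simp
      moreover have "i \<in> ?S (b # h) p \<longleftrightarrow> j \<in> ?T"
        unfolding Suc by (cases p) simp_all
      ultimately show ?thesis using Suc by simp
    qed auto
  qed
  then have "wocc a g (b # h) p = card ((if a = b \<and> p = g @ h then {0} else {}) \<union> Suc ` ?T)"
    by (simp only: wocc_def)
  also have "\<dots> = card (if a = b \<and> p = g @ h then {0::nat} else {}) + card (Suc ` ?T)"
    by (rule card_Un_disjoint) auto
  finally show ?thesis by (auto simp: card_image wocc_def)
qed

text \<open>The bridge from the substitutions that define \<open>d1\<close> and the bracket to
  derivations. Any finite \<open>D\<close> that contains the support of \<open>X\<close> gives the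
  same sum.\<close>

lemma der_eq_sum_wocc:
  assumes "finite D" "\<And>a g. X a g \<noteq> 0 \<Longrightarrow> (a, g) \<in> D"
  shows "(\<Sum>(a, g)\<in>D. X a g * of_nat (wocc a g h p)) = der X h p"
proof (induction h arbitrary: p)
  case (Cons b h)
  have "(\<Sum>(a, g)\<in>D. X a g * of_nat (if a = b \<and> p = g @ h then 1 else 0)) = right_mult h (X b) p"
  proof (cases "\<exists>q. p = q @ h")
    case True
    then obtain q where p: "p = q @ h" by blast
    have "(\<Sum>(a, g)\<in>D. X a g * of_nat (if a = b \<and> p = g @ h then 1 else 0))
      = (\<Sum>z\<in>D. if z = (b, q) then X b q else 0)"
      by (intro sum.cong) (auto simp: p split: if_split_asm)
    also have "\<dots> = X b q" using assms by auto
    finally show ?thesis by (simp add: p)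
  next
    case False
    then have "(\<Sum>(a, g)\<in>D. X a g * of_nat (if a = b \<and> p = g @ h then 1 else 0)) = 0"
      by (intro sum.neutral) auto
    moreover have "right_mult h (X b) p = 0" using False by (intro right_mult_eq_0) auto
    ultimately show ?thesis by simp
  qed
  moreover have "(\<Sum>(a, g)\<in>D. X a g * of_nat (if p \<noteq> [] \<and> hd p = b then wocc a g h (tl p) else 0))
      = left_mult [b] (der X h) p"
    using Cons.IH[of "tl p"] by (cases p) (auto simp: left_mult_def)
  ultimately show ?case
    by (simp add: wocc_Cons distrib_left sum.distrib case_prod_unfold)
qed (simp add: case_prod_unfold)

section \<open>Monomial algebras\<close>

text \<open>The words of basis paths, without their sources. A nonempty word determines its source,
  and dropping it makes the words of an algebra and of its gluing comparable.\<close>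

definition ok :: "('v,'a) mon \<Rightarrow> 'a list \<Rightarrow> bool" where
  "ok L as \<longleftrightarrow> set as \<subseteq> Es L \<and> successively (\<lambda>a b. tg L a = sr L b) as
     \<and> (\<forall>r\<in>Zs L. \<not> sublist r as)"

text \<open>\<open>chain\<close> with the target fixed as well. The empty word is a walk at every
  element of the vertex type, also outside \<open>Vs L\<close>.\<close>

primrec walk :: "('v,'a) mon \<Rightarrow> 'v \<Rightarrow> 'a list \<Rightarrow> 'v \<Rightarrow> bool" where
  "walk L v [] v' \<longleftrightarrow> v = v'"
| "walk L v (a # as) v' \<longleftrightarrow> sr L a = v \<and> walk L (tg L a) as v'"

lemma chain_iff:
  "chain s t v as \<longleftrightarrow> successively (\<lambda>a b. t a = s b) as \<and> (as \<noteq> [] \<longrightarrow> s (hd as) = v)"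
proof (induction as arbitrary: v)
  case (Cons a as)
  show ?case unfolding chain.simps Cons.IH by (cases as) (simp_all, metis)
qed simp

lemma walk_iff: "walk L v as v' \<longleftrightarrow> chain (sr L) (tg L) v as \<and> ptgt L (v, as) = v'"
  by (induction as arbitrary: v) (auto simp: ptgt_def)

lemma walk_append: "walk L v (x @ y) v' \<longleftrightarrow> (\<exists>m. walk L v x m \<and> walk L m y v')"
  by (induction x arbitrary: v) auto

lemma walk_tgt_unique: "walk L v as m \<Longrightarrow> walk L v as m' \<Longrightarrow> m = m'"
  by (simp add: walk_iff)

lemma walk_src_unique: "walk L m as v \<Longrightarrow> walk L m' as v \<Longrightarrow> m = m'"
  by (cases as) auto

lemma walk_hd: "walk L v as v' \<Longrightarrow> as \<noteq> [] \<Longrightarrow> sr L (hd as) = v"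
  by (cases as) auto

lemma walk_last: "walk L v as v' \<Longrightarrow> as \<noteq> [] \<Longrightarrow> tg L (last as) = v'"
  by (auto simp: walk_iff ptgt_def)

lemma walk_successively: "walk L v as v' \<Longrightarrow> successively (\<lambda>a b. tg L a = sr L b) as"
  by (simp add: walk_iff chain_iff)

lemma successively_walk:
  assumes "successively (\<lambda>a b. tg L a = sr L b) as" "as \<noteq> []"
  shows "walk L (sr L (hd as)) as (tg L (last as))"
  using assms by (simp add: walk_iff chain_iff ptgt_def)

lemma ok_walk: "ok L as \<Longrightarrow> as \<noteq> [] \<Longrightarrow> walk L (sr L (hd as)) as (tg L (last as))"
  by (rule successively_walk) (auto simp: ok_def)

lemma ok_infix: "ok L (x @ y @ z) \<Longrightarrow> ok L y"
  using sublist_appendI[of y x z] sublist_order.order.trans[of _ y "x @ y @ z"]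
  by (auto simp: ok_def successively_append_iff)

lemma ok_appendL: "ok L (x @ y) \<Longrightarrow> ok L x" and ok_appendR: "ok L (x @ y) \<Longrightarrow> ok L y"
  using ok_infix[of L "[]" x y] ok_infix[of L x y "[]"] by simp_all

lemma ok_no_rel: "r \<in> Zs L \<Longrightarrow> \<not> ok L (x @ r @ y)"
  by (auto simp: ok_def)

lemma mem_basis:
  "(v, as) \<in> basis L \<longleftrightarrow> v \<in> Vs L \<and> ok L as \<and> (as \<noteq> [] \<longrightarrow> sr L (hd as) = v)"
  by (auto simp: basis_def paths_def ok_def chain_iff)

lemma der_walk:
  assumes X: "\<And>a g. X a g \<noteq> 0 \<Longrightarrow> walk L (sr L a) g (tg L a)"
    and us: "walk L v us v'" and nz: "der X us p \<noteq> 0"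
  shows "walk L v p v'"
proof -
  obtain r1 a r2 g where "us = r1 @ a # r2" "p = r1 @ g @ r2" "X a g \<noteq> 0"
    using nz by (rule der_nonzeroE)
  then show ?thesis using us X[of a g] by (auto simp: walk_append)
qed

text \<open>The part before the replaced letter fixes where the inserted word starts, and the part
  after it where it ends. If the outcome still runs from \<open>v\<close> to \<open>v'\<close>, the
  inserted word is parallel to the letter, which the assumption on \<open>X\<close>
  excludes.\<close>

lemma der_not_walk:
  assumes X: "\<And>a g. X a g \<noteq> 0 \<Longrightarrow> \<not> walk L (sr L a) g (tg L a)"
    and us: "walk L v us v'" and p: "walk L v p v'"
  shows "der X us p = 0"
proof (rule ccontr)
  assume "der X us p \<noteq> 0"
  then obtain r1 a r2 g where r: "us = r1 @ a # r2" "p = r1 @ g @ r2" "X a g \<noteq> 0"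
    by (rule der_nonzeroE)
  have 1: "walk L v r1 (sr L a)" "walk L (tg L a) r2 v'" using us r(1) by (auto simp: walk_append)
  obtain m m' where "walk L v r1 m" "walk L m g m'" "walk L m' r2 v'"
    using p r(2) by (auto simp: walk_append)
  then have "walk L (sr L a) g (tg L a)"
    using 1 walk_tgt_unique walk_src_unique by metis
  then show False using X r(3) by blast
qed

text \<open>In a pair \<open>a || \<gamma>\<close> the source of the path \<open>\<gamma>\<close> is that of \<open>a\<close>, so the coefficients of an
  element of \<open>k(Q\<^sub>1 || \<B>)\<close> are indexed by an arrow and a word.  This indexing is the same for
  an algebra and for its gluing.\<close>
definition rep :: "('v,'a) mon \<Rightarrow> (('v,'a) ppair \<Rightarrow> 'k) \<Rightarrow> 'a \<Rightarrow> 'a list \<Rightarrow> 'k" where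
  "rep L x a g = x (apath L a, (sr L a, g))"

text \<open>A right inverse of \<open>rep\<close>, extended by 0 to pairs that are not an arrow with
  a path from the source of that arrow.\<close>

definition emb :: "('v,'a) mon \<Rightarrow> ('a \<Rightarrow> 'a list \<Rightarrow> 'k::zero) \<Rightarrow> ('v,'a) ppair \<Rightarrow> 'k" where
  "emb L X q = (let a = hd (snd (fst q)); g = snd (snd q)
     in if q = (apath L a, (sr L a, g)) then X a g else 0)"

lemma rep_emb [simp]: "rep L (emb L X) = X"
  by (simp add: rep_def emb_def apath_def fun_eq_iff)

lemma rep_add [simp]: "rep L (x + y) a g = rep L x a g + rep L y a g"
  and rep_diff [simp]: "rep L (x - y) a g = rep L x a g - rep L y a g"
  and rep_scal [simp]: "rep L (scal c x) a g = c * rep L x a g"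
  and rep_0 [simp]: "rep L 0 a g = 0"
  by (simp_all add: rep_def)

lemma rep_sum: "rep L (\<Sum>i\<in>I. f i) a g = (\<Sum>i\<in>I. rep L (f i) a g)"
  by (simp add: rep_def sum_fun_apply)

abbreviation arrow_pairs :: "('v,'a) mon \<Rightarrow> ('v,'a) ppair set" where
  "arrow_pairs L \<equiv> par L (apaths L) (basis L)"

abbreviation vertex_pairs :: "('v,'a) mon \<Rightarrow> ('v,'a) ppair set" where
  "vertex_pairs L \<equiv> par L (vpaths L) (basis L)"

text \<open>The word-level form of \<open>d0b\<close> on the pair \<open>v || c\<close>.\<close>
definition inn :: "('v,'a) mon \<Rightarrow> 'v \<Rightarrow> 'a list \<Rightarrow> 'a \<Rightarrow> 'a list \<Rightarrow> 'k::comm_ring_1" where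
  "inn L v c a g = (if a \<in> Es L \<and> ok L g
     then (if sr L a = v \<and> g = c @ [a] then 1 else 0) - (if tg L a = v \<and> g = a # c then 1 else 0)
     else 0)"

lemma inn_triv: "a \<in> Es L \<Longrightarrow> ok L [a] \<Longrightarrow>
    inn L v c a [a] = (if c = [] then (if sr L a = v then 1 else 0) - (if tg L a = v then 1 else 0) else 0)"
  by (simp add: inn_def)

text \<open>The sum over the letters of the word telescopes.\<close>
lemma der_inn:
  assumes "walk L v1 g v2" "set g \<subseteq> Es L" "ok L p"
  shows "der (inn L v c) g p
    = (if v1 = v \<and> p = c @ g then 1 else 0) - (if v2 = v \<and> p = g @ c then 1 else (0::'k::comm_ring_1))"
  using assms
proof (induction g arbitrary: v1 p)
  case (Cons b g)
  have b: "sr L b = v1" "b \<in> Es L" "walk L (tg L b) g v2" "set g \<subseteq> Es L" using Cons.prems by auto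
  have 1: "right_mult g (inn L v c b) p = (if v1 = v \<and> p = c @ b # g then 1 else 0)
      - (if tg L b = v \<and> p = b # c @ g then 1 else (0::'k))"
  proof (cases "\<exists>q. p = q @ g")
    case True
    then obtain q where p: "p = q @ g" by blast
    then have "ok L q" using Cons.prems(3) ok_appendL[of L q g] by simp
    moreover have "p = c @ b # g \<longleftrightarrow> q = c @ [b]" "p = b # c @ g \<longleftrightarrow> q = b # c"
      unfolding p by (metis append_same_eq append.assoc append_Cons append_Nil)+
    ultimately show ?thesis using b by (simp add: p inn_def)
  next
    case False
    then have "p \<noteq> c @ b # g" "p \<noteq> b # c @ g"
      by (metis append.assoc append_Cons append_Nil)+
    moreover have "right_mult g (inn L v c b) p = 0" using False by (intro right_mult_eq_0) auto
    ultimately show ?thesis by simp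
  qed
  have 2: "left_mult [b] (der (inn L v c) g) p = (if tg L b = v \<and> p = b # c @ g then 1 else 0)
      - (if v2 = v \<and> p = b # g @ c then 1 else (0::'k))"
  proof (cases "\<exists>q. p = b # q")
    case True
    then obtain q where p: "p = [b] @ q" by auto
    then have "ok L q" using Cons.prems(3) ok_appendR[of L "[b]" q] by simp
    then have "der (inn L v c) g q = (if tg L b = v \<and> q = c @ g then 1 else 0)
      - (if v2 = v \<and> q = g @ c then 1 else (0::'k))"
      by (rule Cons.IH[OF b(3,4)])
    then show ?thesis by (simp only: p left_mult_append) simp
  next
    case False
    then have "left_mult [b] (der (inn L v c) g) p = 0" by (intro left_mult_eq_0) auto
    then show ?thesis using False by auto
  qed
  show ?case using 1 2 by simp
qed auto

text \<open>The conditions collected here pass from an algebra to its gluing, so that both become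
  instances.\<close>

locale monomial =
  fixes L :: "('v,'a) mon"
  assumes finite_E: "finite (Es L)" and finite_basis: "finite (basis L)"
    and quiver: "\<And>a. a \<in> Es L \<Longrightarrow> sr L a \<in> Vs L" "\<And>a. a \<in> Es L \<Longrightarrow> tg L a \<in> Vs L"
    and rel_length: "\<And>r. r \<in> Zs L \<Longrightarrow> 2 \<le> length r"
    and rel_arrows: "\<And>r. r \<in> Zs L \<Longrightarrow> set r \<subseteq> Es L"
    and rel_walk: "\<And>r. r \<in> Zs L \<Longrightarrow> walk L (sr L (hd r)) r (tg L (last r))"
begin

section \<open>Finiteness and the bases of parallel pairs\<close>

lemma ok_Nil: "ok L []"
  using rel_length by (fastforce simp: ok_def)

lemma ok_single: "a \<in> Es L \<Longrightarrow> ok L [a]"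
  using rel_length by (fastforce simp: ok_def dest: sublist_length_le)

lemma basis_of_ok: "ok L as \<Longrightarrow> as \<noteq> [] \<Longrightarrow> (sr L (hd as), as) \<in> basis L"
  using quiver(1) hd_in_set by (fastforce simp: mem_basis ok_def)

lemma finite_ok: "finite {g. ok L g}"
proof (rule finite_subset)
  show "{g. ok L g} \<subseteq> insert [] (snd ` basis L)"
    using basis_of_ok by force
qed (simp add: finite_basis)

lemma finite_V: "finite (Vs L)"
proof (rule finite_subset)
  have "(v, []) \<in> basis L" if "v \<in> Vs L" for v
    using ok_Nil that by (simp add: mem_basis)
  then show "Vs L \<subseteq> fst ` basis L" by force
qed (simp add: finite_basis)

lemma basis_of_walk: "ok L g \<Longrightarrow> v \<in> Vs L \<Longrightarrow> walk L v g v' \<Longrightarrow> (v, g) \<in> basis L"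
  by (auto simp: mem_basis dest: walk_hd)

lemma basis_ptgt_iff:
  "(v, g) \<in> basis L \<and> ptgt L (v, g) = v' \<longleftrightarrow> v \<in> Vs L \<and> ok L g \<and> walk L v g v'"
  by (auto simp: mem_basis walk_iff chain_iff ok_def)

lemma mem_arrow_pairs:
  "q \<in> arrow_pairs L \<longleftrightarrow> (\<exists>a g. a \<in> Es L \<and> ok L g \<and> walk L (sr L a) g (tg L a)
     \<and> q = (apath L a, (sr L a, g)))"
proof -
  obtain x y where q: "q = (x, y)" by (rule prod.exhaust)
  have "parallel L (apath L a) (v, g) \<longleftrightarrow> v = sr L a \<and> ptgt L (v, g) = tg L a" for a v g
    by (auto simp: parallel_def apath_def ptgt_def)
  then have "q \<in> arrow_pairs L \<longleftrightarrow> (\<exists>a g. a \<in> Es L \<and> ((sr L a, g) \<in> basis L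
      \<and> ptgt L (sr L a, g) = tg L a) \<and> q = (apath L a, (sr L a, g)))"
    by (cases y) (auto simp: par_def apaths_def q)
  then show ?thesis
    unfolding basis_ptgt_iff using quiver(1) by metis
qed

lemma mem_vertex_pairs:
  "q \<in> vertex_pairs L \<longleftrightarrow> (\<exists>v c. v \<in> Vs L \<and> ok L c \<and> walk L v c v \<and> q = ((v, []), (v, c)))"
proof -
  obtain x y where q: "q = (x, y)" by (rule prod.exhaust)
  have "parallel L (v, []) (v', g) \<longleftrightarrow> v' = v \<and> ptgt L (v', g) = v" for v v' g
    by (auto simp: parallel_def ptgt_def)
  then have "q \<in> vertex_pairs L \<longleftrightarrow> (\<exists>v g. v \<in> Vs L \<and> ((v, g) \<in> basis L
      \<and> ptgt L (v, g) = v) \<and> q = ((v, []), (v, g)))"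
    by (cases y) (auto simp: par_def vpaths_def q)
  then show ?thesis
    unfolding basis_ptgt_iff by metis
qed

lemma finite_arrow_pairs: "finite (arrow_pairs L)"
  by (rule finite_subset[of _ "apaths L \<times> basis L"])
    (auto simp: par_def apaths_def finite_E finite_basis)

lemma finite_vertex_pairs: "finite (vertex_pairs L)"
  by (rule finite_subset[of _ "vpaths L \<times> basis L"])
    (auto simp: par_def vpaths_def finite_V finite_basis)

lemma rep_support:
  assumes "x \<in> fspace (arrow_pairs L)" "rep L x a g \<noteq> 0"
  shows "a \<in> Es L" "ok L g" "walk L (sr L a) g (tg L a)"
proof -
  have "(apath L a, (sr L a, g)) \<in> arrow_pairs L"
    using assms unfolding fspace_def rep_def by blast
  then show "a \<in> Es L" "ok L g" "walk L (sr L a) g (tg L a)"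
    unfolding mem_arrow_pairs by (auto simp: apath_def)
qed

lemma rep_eqI:
  assumes x: "x \<in> fspace (arrow_pairs L)" and y: "y \<in> fspace (arrow_pairs L)"
    and eq: "\<And>a g. a \<in> Es L \<Longrightarrow> ok L g \<Longrightarrow> rep L x a g = rep L y a g"
  shows "x = y"
proof
  fix q show "x q = y q"
  proof (cases "q \<in> arrow_pairs L")
    case True
    then show ?thesis using eq by (auto simp: mem_arrow_pairs rep_def)
  next
    case False
    then have "x q = 0" "y q = 0" using x y unfolding fspace_def by blast+
    then show ?thesis by simp
  qed
qed

lemma emb_fspace:
  assumes "\<And>a g. X a g \<noteq> 0 \<Longrightarrow> a \<in> Es L \<and> ok L g \<and> walk L (sr L a) g (tg L a)"
  shows "emb L X \<in> fspace (arrow_pairs L)"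
proof -
  have "q \<in> arrow_pairs L" if "emb L X q \<noteq> 0" for q
    using that assms unfolding emb_def Let_def mem_arrow_pairs by metis
  then show ?thesis unfolding fspace_def by blast
qed

lemma sum_arrow_pairs:
  assumes "\<And>q. q \<in> arrow_pairs L \<Longrightarrow> fst q \<noteq> apath L a \<Longrightarrow> F q = 0"
    and "\<And>g. (apath L a, (sr L a, g)) \<notin> arrow_pairs L \<Longrightarrow> F (apath L a, (sr L a, g)) = 0"
  shows "(\<Sum>q\<in>arrow_pairs L. F q) = (\<Sum>g\<in>{g. ok L g}. F (apath L a, (sr L a, g)))"
proof -
  let ?h = "\<lambda>g. (apath L a, (sr L a, g))"
  have "(\<Sum>g\<in>{g. ok L g}. F (?h g)) = (\<Sum>q\<in>?h ` {g. ok L g}. F q)"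
    by (subst sum.reindex) (auto simp: inj_on_def)
  also have "\<dots> = (\<Sum>q\<in>arrow_pairs L. F q)"
  proof (rule sum.mono_neutral_cong)
    show "F q = 0" if "q \<in> arrow_pairs L - ?h ` {g. ok L g}" for q
      using that by (intro assms(1)) (auto simp: mem_arrow_pairs apath_def)
    show "F q = 0" if "q \<in> ?h ` {g. ok L g} - arrow_pairs L" for q
      using that assms(2) by auto
  qed (auto simp: finite_ok finite_arrow_pairs)
  finally show ?thesis by simp
qed

text \<open>A substitution keeps the source, which explains \<open>s' = s\<close>. The sum over
  pairs is a sum over arrows and words, to which \<open>der_eq_sum_wocc\<close> applies.\<close>

lemma sum_substc:
  assumes x: "x \<in> fspace (arrow_pairs L)"
  shows "(\<Sum>z\<in>arrow_pairs L. x z * substc L z (s, h) (s', p))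
    = (if (s', p) \<in> basis L \<and> s' = s then der (rep L x) h p else 0)"
proof (cases "(s', p) \<in> basis L \<and> s' = s")
  case True
  let ?D = "{(a, g). a \<in> Es L \<and> ok L g \<and> walk L (sr L a) g (tg L a)}"
  let ?h = "\<lambda>(a, g). (apath L a, (sr L a, g))"
  have fin: "finite ?D"
    by (rule finite_subset[of _ "Es L \<times> {g. ok L g}"]) (auto simp: finite_E finite_ok)
  have "arrow_pairs L = ?h ` ?D"
    by (auto simp: mem_arrow_pairs image_def)
  then have "(\<Sum>z\<in>arrow_pairs L. x z * substc L z (s, h) (s', p))
      = (\<Sum>z\<in>?D. x (?h z) * substc L (?h z) (s, h) (s', p))"
    by (simp only:) (subst sum.reindex, auto simp: inj_on_def apath_def)
  also have "\<dots> = (\<Sum>(a, g)\<in>?D. rep L x a g * of_nat (wocc a g h p))"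
    using True by (intro sum.cong) (auto simp: substc_def occ_eq rep_def apath_def)
  also have "\<dots> = der (rep L x) h p"
    using rep_support[OF x] by (intro der_eq_sum_wocc[OF fin]) auto
  finally show ?thesis unfolding if_P[OF True] .
next
  case False
  then have "x z * substc L z (s, h) (s', p) = 0" for z
    by (auto simp: substc_def occ_eq)
  then show ?thesis unfolding if_not_P[OF False] by simp
qed

section \<open>The kernel of \<open>d1\<close> as a space of derivations\<close>

lemma d1_eq:
  assumes x: "x \<in> fspace (arrow_pairs L)"
  shows "d1 L x ((s, r), (s', p))
    = (if (s, r) \<in> rpaths L \<and> (s', p) \<in> basis L \<and> s' = s then der (rep L x) r p else 0)"
proof (cases "(s, r) \<in> rpaths L")
  case True
  then have "d1 L x ((s, r), (s', p)) = (\<Sum>z\<in>arrow_pairs L. x z * substc L z (s, r) (s', p))"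
    by (simp add: d1_def linext_def d1b_def)
  then show ?thesis using True by (simp add: sum_substc[OF x])
next
  case False
  then show ?thesis by (simp add: d1_def linext_def d1b_def)
qed

text \<open>All nonzero words are tested, without regard to end points: at a word not parallel to
  \<open>r\<close> the derivation vanishes by \<open>der_walk\<close>. In this form the conditions
  for an algebra and for its gluing can be compared.\<close>

lemma mem_ker1_iff:
  "x \<in> ker1 L \<longleftrightarrow> x \<in> fspace (arrow_pairs L)
     \<and> (\<forall>r\<in>Zs L. \<forall>p. ok L p \<longrightarrow> der (rep L x) r p = 0)"
proof (intro iffI conjI ballI allI impI)
  assume "x \<in> ker1 L"
  then show x: "x \<in> fspace (arrow_pairs L)" by (simp add: ker1_def)
  fix r p assume r: "r \<in> Zs L" and p: "ok L p"
  show "der (rep L x) r p = 0"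
  proof (rule ccontr)
    assume nz: "der (rep L x) r p \<noteq> 0"
    have "walk L (sr L (hd r)) p (tg L (last r))"
      by (rule der_walk[OF rep_support(3)[OF x] rel_walk[OF r] nz])
    moreover have "r \<noteq> []" using rel_length[OF r] by auto
    then have "sr L (hd r) \<in> Vs L" using rel_arrows[OF r] hd_in_set quiver(1) by blast
    ultimately have "(sr L (hd r), p) \<in> basis L" using p by (intro basis_of_walk)
    moreover have "(sr L (hd r), r) \<in> rpaths L" using r by (auto simp: rpaths_def)
    ultimately have "d1 L x ((sr L (hd r), r), (sr L (hd r), p)) = der (rep L x) r p"
      by (simp add: d1_eq[OF x])
    moreover have "d1 L x q = 0" for q using \<open>x \<in> ker1 L\<close> by (simp add: ker1_def)
    ultimately show False using nz by simp
  qed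
next
  assume *: "x \<in> fspace (arrow_pairs L) \<and> (\<forall>r\<in>Zs L. \<forall>p. ok L p \<longrightarrow> der (rep L x) r p = 0)"
  have "d1 L x ((s, r), (s', p)) = 0" for s r s' p
    using * by (auto simp: d1_eq rpaths_def mem_basis)
  then have "d1 L x = (\<lambda>_. 0)" by (intro ext) (metis surj_pair)
  then show "x \<in> ker1 L" using * by (simp add: ker1_def)
qed

lemma subspace_ker1: "fn.subspace (ker1 L :: (('v,'a) ppair \<Rightarrow> 'k::field) set)"
proof -
  have "flinear (d1 L :: (('v,'a) ppair \<Rightarrow> 'k) \<Rightarrow> _)"
    by (rule flinearI)
      (auto simp: d1_def linext_def fun_eq_iff algebra_simps sum.distrib sum_distrib_left)
  moreover have "ker1 L = fspace (arrow_pairs L) \<inter> {x. d1 L x = (0 :: ('v,'a) ppair \<Rightarrow> 'k)}"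
    unfolding ker1_def zero_fun_def by blast
  ultimately show ?thesis
    using fn.subspace_inter[OF subspace_fspace] module_hom.subspace_kernel by metis
qed

text \<open>The derivation of a kernel element preserves the whole ideal and not just its
  generators. In \<open>q1 @ r @ q2\<close> the Leibniz terms that leave \<open>r\<close> intact
  vanish at words without relations, and the remaining one applies the derivation to
  \<open>r\<close>.\<close>

lemma ker1_der_eq_0:
  assumes x: "x \<in> ker1 L" and us: "set us \<subseteq> Es L" "walk L v us v'" "\<not> ok L us" and p: "ok L p"
  shows "der (rep L x) us p = 0"
proof -
  obtain r q1 q2 where r: "r \<in> Zs L" "us = q1 @ r @ q2"
    using us walk_successively[OF us(2)] by (auto simp: ok_def sublist_def)
  let ?D = "der (rep L x)"
  have "?D us = right_mult (r @ q2) (?D q1) + left_mult q1 (right_mult q2 (?D r) + left_mult r (?D q2))"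
    by (simp only: r(2) der_append)
  moreover have "right_mult (r @ q2) (?D q1) p = 0"
  proof (rule right_mult_eq_0)
    fix q assume "p = q @ r @ q2"
    then show "?D q1 q = 0" using ok_no_rel[OF r(1)] p by simp
  qed
  moreover have "left_mult q1 (right_mult q2 (?D r) + left_mult r (?D q2)) p = 0"
  proof (rule left_mult_eq_0)
    fix q assume q: "p = q1 @ q"
    have "right_mult q2 (?D r) q = 0"
    proof (rule right_mult_eq_0)
      fix h assume "q = h @ q2"
      then have "ok L h" using p q ok_infix by metis
      then show "?D r h = 0" using x r(1) by (simp add: mem_ker1_iff)
    qed
    moreover have "left_mult r (?D q2) q = 0"
    proof (rule left_mult_eq_0)
      fix h assume "q = r @ h"
      then show "?D q2 h = 0" using ok_no_rel[OF r(1)] p q by simp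
    qed
    ultimately show "(right_mult q2 (?D r) + left_mult r (?D q2)) q = 0" by simp
  qed
  ultimately show ?thesis by simp
qed

section \<open>Inner derivations and the image of \<open>d0\<close>\<close>

lemma d0_bv: "q \<in> vertex_pairs L \<Longrightarrow> d0 L (bv q) = (d0b L q :: _ \<Rightarrow> 'k::field)"
  unfolding d0_def by (rule linext_bv[OF finite_vertex_pairs])

lemma rep_d0b:
  assumes v: "v \<in> Vs L" and c: "ok L c" "walk L v c v"
  shows "rep L (d0b L ((v, []), (v, c))) a g = (inn L v c a g :: 'k::comm_ring_1)"
proof -
  have "sr L a = v \<Longrightarrow> (v, c @ [a]) \<in> basis L \<longleftrightarrow> ok L (c @ [a])"
    using v c(2) walk_hd[OF c(2)] by (cases c) (auto simp: mem_basis)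
  then have 1: "(\<exists>a'\<in>Es L. sr L a' = v \<and> (v, c @ [a']) \<in> basis L
        \<and> (apath L a, sr L a, g) = (apath L a', v, c @ [a']))
      \<longleftrightarrow> a \<in> Es L \<and> ok L g \<and> sr L a = v \<and> g = c @ [a]"
    by (auto simp: apath_def)
  have "a \<in> Es L \<Longrightarrow> (sr L a, a # c) \<in> basis L \<longleftrightarrow> ok L (a # c)"
    using quiver(1) by (simp add: mem_basis)
  then have 2: "(\<exists>a'\<in>Es L. tg L a' = v \<and> (sr L a', a' # c) \<in> basis L
        \<and> (apath L a, sr L a, g) = (apath L a', sr L a', a' # c))
      \<longleftrightarrow> a \<in> Es L \<and> ok L g \<and> tg L a = v \<and> g = a # c"
    by (auto simp: apath_def)
  show ?thesis
    unfolding rep_def d0b_def fst_conv snd_conv 1 2 inn_def by auto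
qed

lemma d0b_fspace:
  assumes "v \<in> Vs L" "ok L c" "walk L v c v"
  shows "d0b L ((v, []), (v, c)) \<in> fspace (arrow_pairs L)"
proof -
  have "q \<in> arrow_pairs L" if nz: "d0b L ((v, []), (v, c)) q \<noteq> (0::'k::comm_ring_1)" for q
  proof -
    let ?P = "\<exists>a\<in>Es L. sr L a = v \<and> (v, c @ [a]) \<in> basis L \<and> q = (apath L a, (v, c @ [a]))"
    let ?Q = "\<exists>a\<in>Es L. tg L a = v \<and> (sr L a, a # c) \<in> basis L \<and> q = (apath L a, (sr L a, a # c))"
    have "?P \<or> ?Q"
    proof (rule ccontr)
      assume "\<not> (?P \<or> ?Q)"
      then have P: "\<not> ?P" and Q: "\<not> ?Q" by simp_all
      show False
        using nz unfolding d0b_def fst_conv snd_conv if_not_P[OF P] if_not_P[OF Q] by simp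
    qed
    then show ?thesis
    proof
      assume ?P
      then obtain a where "a \<in> Es L" "sr L a = v" "(v, c @ [a]) \<in> basis L"
        "q = (apath L a, (v, c @ [a]))" by (elim bexE conjE)
      then show ?thesis using assms(3)
        unfolding mem_arrow_pairs mem_basis
        by (intro exI[of _ a] exI[of _ "c @ [a]"]) (simp add: walk_append)
    next
      assume ?Q
      then obtain a where "a \<in> Es L" "tg L a = v" "(sr L a, a # c) \<in> basis L"
        "q = (apath L a, (sr L a, a # c))" by (elim bexE conjE)
      then show ?thesis using assms(3)
        unfolding mem_arrow_pairs mem_basis by (intro exI[of _ a] exI[of _ "a # c"]) simp
    qed
  qed
  then show ?thesis unfolding fspace_def by blast
qed

lemma im0_eq: "im0 L = (fn.span (d0b L ` vertex_pairs L) :: (('v,'a) ppair \<Rightarrow> 'k::field) set)"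
  unfolding im0_def d0_def by (rule linext_image[OF finite_vertex_pairs])

lemma subspace_im0: "fn.subspace (im0 L :: (('v,'a) ppair \<Rightarrow> 'k::field) set)"
  unfolding im0_eq by (rule fn.subspace_span)

lemma d0b_im0:
  assumes "v \<in> Vs L" "ok L c" "walk L v c v"
  shows "d0b L ((v, []), (v, c)) \<in> (im0 L :: (('v,'a) ppair \<Rightarrow> 'k::field) set)"
  using assms unfolding im0_eq by (intro fn.span_base imageI) (auto simp: mem_vertex_pairs)

lemma im0_subset:
  assumes "fn.subspace W"
    and "\<And>v c. v \<in> Vs L \<Longrightarrow> ok L c \<Longrightarrow> walk L v c v \<Longrightarrow> d0b L ((v, []), (v, c)) \<in> W"
  shows "(im0 L :: (('v,'a) ppair \<Rightarrow> 'k::field) set) \<subseteq> W"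
  unfolding im0_eq using assms by (intro fn.span_minimal) (auto simp: mem_vertex_pairs)

text \<open>By \<open>der_inn\<close> an inner derivation takes a relation \<open>r\<close> to a
  combination of \<open>c @ r\<close> and \<open>r @ c\<close>, and both words contain
  \<open>r\<close>.\<close>

lemma im0_ker1: "im0 L \<subseteq> (ker1 L :: (('v,'a) ppair \<Rightarrow> 'k::field) set)"
proof (rule im0_subset[OF subspace_ker1])
  fix v c assume v: "v \<in> Vs L" and c: "ok L c" "walk L v c v"
  let ?y = "d0b L ((v, []), (v, c)) :: ('v,'a) ppair \<Rightarrow> 'k"
  have rep: "rep L ?y = inn L v c" by (intro ext rep_d0b[OF v c])
  have "der (rep L ?y) r p = 0" if r: "r \<in> Zs L" and p: "ok L p" for r p
  proof -
    have "p \<noteq> c @ r" "p \<noteq> r @ c"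
      using ok_no_rel[OF r, of c "[]"] ok_no_rel[OF r, of "[]" c] p by auto
    then show ?thesis
      unfolding rep by (subst der_inn[OF rel_walk[OF r] rel_arrows[OF r] p]) simp
  qed
  then show "?y \<in> ker1 L"
    unfolding mem_ker1_iff using d0b_fspace[OF v c] by blast
qed

section \<open>The Lie bracket and its ideal of inner derivations\<close>

definition half_br ::
  "(('v,'a) ppair \<Rightarrow> 'k::comm_ring_1) \<Rightarrow> (('v,'a) ppair \<Rightarrow> 'k) \<Rightarrow> ('v,'a) ppair \<Rightarrow> 'k" where
  "half_br x y q = (\<Sum>v\<in>arrow_pairs L. y v * (if fst q = fst v
     then \<Sum>u\<in>arrow_pairs L. x u * substc L u (snd v) (snd q) else 0))"

text \<open>\<open>half_br x y\<close> applies the derivation of \<open>x\<close> to the values of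
  \<open>y\<close>, so the bracket is a commutator of derivations, evaluated on the arrows.\<close>

lemma lbr_eq_half_br: "lbr L x y q = half_br x y q - half_br y x q"
proof -
  let ?A = "\<lambda>u v. if fst q = fst v then substc L u (snd v) (snd q) else 0"
  have "lbr L x y q = (\<Sum>u\<in>arrow_pairs L. \<Sum>v\<in>arrow_pairs L. x u * y v * ?A u v)
      - (\<Sum>u\<in>arrow_pairs L. \<Sum>v\<in>arrow_pairs L. x u * y v * ?A v u)"
    unfolding lbr_def lbrb_def by (simp only: right_diff_distrib sum_subtractf)
  moreover have "(\<Sum>u\<in>arrow_pairs L. \<Sum>v\<in>arrow_pairs L. x u * y v * ?A u v) = half_br x y q"
    unfolding half_br_def sum_distrib_left
    by (subst sum.swap) (intro sum.cong refl, auto simp: sum_distrib_left algebra_simps)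
  moreover have "(\<Sum>u\<in>arrow_pairs L. \<Sum>v\<in>arrow_pairs L. x u * y v * ?A v u) = half_br y x q"
    unfolding half_br_def
    by (intro sum.cong refl) (auto simp: sum_distrib_left algebra_simps)
  ultimately show ?thesis by simp
qed

lemma half_br_nonzero:
  assumes x: "x \<in> fspace (arrow_pairs L)" and nz: "half_br x y q \<noteq> 0"
  shows "q \<in> arrow_pairs L"
proof -
  obtain v where v: "v \<in> arrow_pairs L" "fst q = fst v"
      "(\<Sum>u\<in>arrow_pairs L. x u * substc L u (snd v) (snd q)) \<noteq> 0"
  proof -
    obtain v where "v \<in> arrow_pairs L" "y v * (if fst q = fst v
        then \<Sum>u\<in>arrow_pairs L. x u * substc L u (snd v) (snd q) else 0) \<noteq> 0"
      using nz unfolding half_br_def by (rule sum.not_neutral_contains_not_neutral)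
    then show thesis by (intro that[of v]) (auto split: if_split_asm)
  qed
  obtain a g where a: "a \<in> Es L" "walk L (sr L a) g (tg L a)" "v = (apath L a, (sr L a, g))"
    using v(1) by (auto simp: mem_arrow_pairs)
  obtain s p where s: "snd q = (s, p)" by (rule prod.exhaust)
  have "(s, p) \<in> basis L \<and> s = sr L a" "der (rep L x) g p \<noteq> 0"
    using v(3) unfolding a(3) s snd_conv sum_substc[OF x] by (auto split: if_split_asm)
  moreover from this have "walk L (sr L a) p (tg L a)"
    using der_walk[OF rep_support(3)[OF x] a(2)] by blast
  moreover have "q = (apath L a, (s, p))"
    using v(2) s a(3) by (metis fst_conv prod.collapse)
  ultimately show ?thesis
    unfolding mem_arrow_pairs using a(1) by (auto simp: mem_basis)
qed

lemma rep_half_br: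
  assumes x: "x \<in> fspace (arrow_pairs L)" and y: "y \<in> fspace (arrow_pairs L)"
  shows "rep L (half_br x y) a p
    = (if ok L p then \<Sum>g\<in>{g. ok L g}. rep L y a g * der (rep L x) g p else 0)"
proof (cases "ok L p")
  case True
  let ?F = "\<lambda>v. y v * (if apath L a = fst v
     then \<Sum>u\<in>arrow_pairs L. x u * substc L u (snd v) (sr L a, p) else 0)"
  have "rep L (half_br x y) a p = (\<Sum>v\<in>arrow_pairs L. ?F v)"
    by (simp only: rep_def half_br_def fst_conv snd_conv)
  also have "\<dots> = (\<Sum>g\<in>{g. ok L g}. ?F (apath L a, (sr L a, g)))"
  proof (rule sum_arrow_pairs)
    fix g assume "(apath L a, (sr L a, g)) \<notin> arrow_pairs L"
    then have "y (apath L a, (sr L a, g)) = 0" using y unfolding fspace_def by blast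
    then show "?F (apath L a, (sr L a, g)) = 0" by simp
  qed auto
  also have "\<dots> = (\<Sum>g\<in>{g. ok L g}. rep L y a g
      * (\<Sum>u\<in>arrow_pairs L. x u * substc L u (sr L a, g) (sr L a, p)))"
    by (simp add: rep_def)
  also have "\<dots> = (\<Sum>g\<in>{g. ok L g}. rep L y a g * der (rep L x) g p)"
  proof (intro sum.cong refl)
    fix g
    show "rep L y a g * (\<Sum>u\<in>arrow_pairs L. x u * substc L u (sr L a, g) (sr L a, p))
        = rep L y a g * der (rep L x) g p"
    \<comment> \<open>When neither factor vanishes, \<open>p\<close> is parallel to
      \<open>a\<close>, and the basis condition in \<open>sum_substc\<close> holds.\<close>
    proof (cases "rep L y a g = 0 \<or> der (rep L x) g p = 0")
      case False
      then have a: "a \<in> Es L" "walk L (sr L a) g (tg L a)" using rep_support[OF y] by auto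
      then have "walk L (sr L a) p (tg L a)"
        using der_walk[OF rep_support(3)[OF x] a(2)] False by blast
      then have "(sr L a, p) \<in> basis L" using True quiver(1)[OF a(1)] by (intro basis_of_walk)
      then show ?thesis by (simp add: sum_substc[OF x])
    qed (auto simp: sum_substc[OF x])
  qed
  finally show ?thesis using True by simp
next
  case False
  then have "(apath L a, (sr L a, p)) \<notin> arrow_pairs L" by (auto simp: mem_arrow_pairs)
  then have "half_br x y (apath L a, (sr L a, p)) = 0" using half_br_nonzero[OF x] by blast
  then show ?thesis using False by (simp add: rep_def)
qed

lemma lbr_fspace:
  assumes x: "x \<in> fspace (arrow_pairs L)" and y: "y \<in> fspace (arrow_pairs L)"
  shows "lbr L x y \<in> fspace (arrow_pairs L)"
proof -
  have "q \<in> arrow_pairs L" if "lbr L x y q \<noteq> 0" for q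
  proof -
    have "half_br x y q \<noteq> 0 \<or> half_br y x q \<noteq> 0" using that by (auto simp: lbr_eq_half_br)
    then show ?thesis using half_br_nonzero[OF x] half_br_nonzero[OF y] by blast
  qed
  then show ?thesis unfolding fspace_def by blast
qed

lemma rep_lbr:
  assumes x: "x \<in> fspace (arrow_pairs L)" and y: "y \<in> fspace (arrow_pairs L)"
  shows "rep L (lbr L x y) a p
    = (if ok L p then (\<Sum>g\<in>{g. ok L g}. rep L y a g * der (rep L x) g p)
        - (\<Sum>g\<in>{g. ok L g}. rep L x a g * der (rep L y) g p) else 0)"
proof -
  have "rep L (lbr L x y) a p = rep L (half_br x y) a p - rep L (half_br y x) a p"
    by (simp add: rep_def lbr_eq_half_br)
  then show ?thesis by (simp add: rep_half_br[OF x y] rep_half_br[OF y x])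
qed

lemma lbr_commute: "lbr L y x = - lbr L x y"
  by (simp add: fun_eq_iff lbr_eq_half_br)

lemma lbr_linear: "flinear (lbr L x)"
  by (rule flinearI)
    (simp_all add: lbr_def fun_eq_iff algebra_simps sum.distrib sum_distrib_left)

text \<open>The derivation of \<open>x\<close> is applied to the commutator of \<open>c\<close> and
  \<open>a\<close>. A product such as \<open>c @ [a]\<close> that is not a basis word is absent from
  the sum, but its derivative vanishes by \<open>ker1_der_eq_0\<close>, so the Leibniz rule can be
  used in all cases.\<close>

lemma sum_inn_der:
  assumes x: "x \<in> ker1 L" and c: "ok L c" "walk L v c v" and a: "a \<in> Es L" and p: "ok L p"
  shows "(\<Sum>g\<in>{g. ok L g}. inn L v c a g * der (rep L x) g p)
    = (if sr L a = v then right_mult [a] (der (rep L x) c) p + left_mult c (rep L x a) p else 0)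
      - (if tg L a = v then right_mult c (rep L x a) p + left_mult [a] (der (rep L x) c) p else (0::'k::field))"
proof -
  let ?D = "der (rep L x)"
  have cE: "set c \<subseteq> Es L" using c by (simp add: ok_def)
  have "inn L v c a g * ?D g p = (if g = c @ [a] then if sr L a = v then ?D (c @ [a]) p else 0 else 0)
      - (if g = a # c then if tg L a = v then ?D (a # c) p else 0 else 0)" if "ok L g" for g
    using that a by (auto simp: inn_def simp del: der.simps)
  then have "(\<Sum>g\<in>{g. ok L g}. inn L v c a g * ?D g p)
    = (\<Sum>g\<in>{g. ok L g}. if g = c @ [a] then if sr L a = v then ?D (c @ [a]) p else 0 else 0)
      - (\<Sum>g\<in>{g. ok L g}. if g = a # c then if tg L a = v then ?D (a # c) p else 0 else 0)"
    by (simp add: sum_subtractf[symmetric] del: der.simps)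
  also have "(\<Sum>g\<in>{g. ok L g}. if g = c @ [a] then if sr L a = v then ?D (c @ [a]) p else 0 else 0)
      = (if sr L a = v then ?D (c @ [a]) p else 0)"
  proof (cases "sr L a = v")
    case True
    then have "walk L v (c @ [a]) (tg L a)" using c(2) by (simp add: walk_append)
    then have "\<not> ok L (c @ [a]) \<Longrightarrow> ?D (c @ [a]) p = 0"
      using ker1_der_eq_0[OF x _ _ _ p] cE a by simp
    then show ?thesis using True finite_ok by auto
  qed simp
  also have "(\<Sum>g\<in>{g. ok L g}. if g = a # c then if tg L a = v then ?D (a # c) p else 0 else 0)
      = (if tg L a = v then ?D (a # c) p else 0)"
  proof (cases "tg L a = v")
    case True
    then have "walk L (sr L a) (a # c) v" using c(2) by simp
    then have "\<not> ok L (a # c) \<Longrightarrow> ?D (a # c) p = 0"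
      using ker1_der_eq_0[OF x _ _ _ p] cE a by (simp del: der.simps)
    then show ?thesis using True finite_ok by (auto simp del: der.simps)
  qed simp
  also have "?D (c @ [a]) p = right_mult [a] (?D c) p + left_mult c (rep L x a) p"
    by (simp add: der_append)
  also have "?D (a # c) p = right_mult c (rep L x a) p + left_mult [a] (?D c) p"
    by simp
  finally show ?thesis .
qed

text \<open>The commutator of \<open>c\<close> with the value of \<open>x\<close> at
  \<open>a\<close>. Every word of that value has the end points of \<open>a\<close>, so the
  conditions in \<open>der_inn\<close> become conditions on \<open>a\<close>.\<close>

lemma sum_der_inn:
  assumes x: "x \<in> fspace (arrow_pairs L)" and a: "a \<in> Es L" and p: "ok L p"
  shows "(\<Sum>g\<in>{g. ok L g}. rep L x a g * der (inn L v c) g p)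
    = (if sr L a = v then left_mult c (rep L x a) p else 0)
      - (if tg L a = v then right_mult c (rep L x a) p else (0::'k::field))"
proof -
  let ?X = "rep L x a"
  have "?X g * der (inn L v c) g p = (if sr L a = v then ?X g * (if p = c @ g then 1 else 0) else 0)
      - (if tg L a = v then ?X g * (if p = g @ c then 1 else 0) else 0)" for g
  proof (cases "?X g = 0")
    case False
    then have "walk L (sr L a) g (tg L a)" "set g \<subseteq> Es L"
      using rep_support[OF x] by (auto simp: ok_def)
    then show ?thesis by (subst der_inn[OF _ _ p]) auto
  qed simp
  then have "(\<Sum>g\<in>{g. ok L g}. ?X g * der (inn L v c) g p)
    = (if sr L a = v then \<Sum>g\<in>{g. ok L g}. ?X g * (if p = c @ g then 1 else 0) else 0)
      - (if tg L a = v then \<Sum>g\<in>{g. ok L g}. ?X g * (if p = g @ c then 1 else 0) else 0)"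
    by (simp add: sum_subtractf)
  moreover have "(\<Sum>g\<in>{g. ok L g}. ?X g * (if p = c @ g then 1 else 0)) = left_mult c ?X p"
    by (rule sum_left_mult[OF finite_ok]) (auto dest: rep_support[OF x])
  moreover have "(\<Sum>g\<in>{g. ok L g}. ?X g * (if p = g @ c then 1 else 0)) = right_mult c ?X p"
    by (rule sum_right_mult[OF finite_ok]) (auto dest: rep_support[OF x])
  ultimately show ?thesis by simp
qed

text \<open>The inner derivation of a combination \<open>f\<close> of cycles at \<open>v\<close>,
  evaluated at the arrow \<open>a\<close>.\<close>

lemma sum_cycles_inn:
  fixes f :: "'a list \<Rightarrow> 'k::field"
  assumes f: "\<And>g. ok L g \<Longrightarrow> f g \<noteq> 0 \<Longrightarrow> walk L v g v" and a: "a \<in> Es L" and p: "ok L p"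
  shows "(\<Sum>g\<in>{g. ok L g \<and> walk L v g v}. f g * inn L v g a p)
    = (if sr L a = v then right_mult [a] f p else 0) - (if tg L a = v then left_mult [a] f p else 0)"
proof -
  let ?C = "{g. ok L g \<and> walk L v g v}"
  have fin: "finite ?C" using finite_ok by simp
  have "f g * inn L v g a p = (if sr L a = v then f g * (if p = g @ [a] then 1 else 0) else 0)
      - (if tg L a = v then f g * (if p = [a] @ g then 1 else 0) else 0)" for g
    using a p by (simp add: inn_def)
  then have "(\<Sum>g\<in>?C. f g * inn L v g a p)
    = (if sr L a = v then \<Sum>g\<in>?C. f g * (if p = g @ [a] then 1 else 0) else 0)
      - (if tg L a = v then \<Sum>g\<in>?C. f g * (if p = [a] @ g then 1 else 0) else 0)"
    by (simp add: sum_subtractf)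
  moreover have "(\<Sum>g\<in>?C. f g * (if p = g @ [a] then 1 else 0)) = right_mult [a] f p"
    using f p by (intro sum_right_mult[OF fin]) (auto dest: ok_appendL)
  moreover have "(\<Sum>g\<in>?C. f g * (if p = [a] @ g then 1 else 0)) = left_mult [a] f p"
  proof (rule sum_left_mult[OF fin])
    fix g assume "p = [a] @ g" "f g \<noteq> 0"
    then show "g \<in> ?C" using f p ok_appendR[of L "[a]" g] by auto
  qed
  ultimately show ?thesis by simp
qed

text \<open>A derivation \<open>D\<close> satisfies \<open>[D, ad c] = ad (D c)\<close>.\<close>
lemma im0_ideal:
  assumes x: "x \<in> (ker1 L :: (('v,'a) ppair \<Rightarrow> 'k::field) set)" and y: "y \<in> im0 L"
  shows "lbr L x y \<in> im0 L"
proof -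
  have xV: "x \<in> fspace (arrow_pairs L)" using x by (simp add: ker1_def)
  have "lbr L x (d0b L ((v, []), (v, c))) \<in> im0 L"
    if v: "v \<in> Vs L" and c: "ok L c" "walk L v c v" for v c
  proof -
    let ?y = "d0b L ((v, []), (v, c)) :: ('v,'a) ppair \<Rightarrow> 'k"
    let ?C = "{g. ok L g \<and> walk L v g v}"
    \<comment> \<open>The inner derivation given by the value of the derivation of \<open>x\<close>
      on \<open>c\<close>, expanded over the cycles at \<open>v\<close>.\<close>
    let ?z = "\<Sum>g\<in>?C. scal (der (rep L x) c g) (d0b L ((v, []), (v, g)))"
    have yV: "?y \<in> fspace (arrow_pairs L)" by (rule d0b_fspace[OF v c])
    have repy: "rep L ?y = inn L v c" by (intro ext rep_d0b[OF v c])
    have z: "?z \<in> im0 L"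
      using v by (intro fn.subspace_sum[OF subspace_im0] fn.subspace_scale[OF subspace_im0] d0b_im0) auto
    then have zV: "?z \<in> fspace (arrow_pairs L)" using im0_ker1 by (auto simp: ker1_def)
    have "lbr L x ?y = ?z"
    proof (rule rep_eqI[OF lbr_fspace[OF xV yV] zV])
      fix a p assume a: "a \<in> Es L" and p: "ok L p"
      have "rep L ?z a p = (\<Sum>g\<in>?C. der (rep L x) c g * inn L v g a p)"
        unfolding rep_sum rep_scal by (intro sum.cong refl) (simp add: rep_d0b[OF v])
      also have "\<dots> = (if sr L a = v then right_mult [a] (der (rep L x) c) p else 0)
          - (if tg L a = v then left_mult [a] (der (rep L x) c) p else 0)"
        using der_walk[OF rep_support(3)[OF xV] c(2)] by (intro sum_cycles_inn a p) auto
      finally have "rep L ?z a p = \<dots>" .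
      moreover have "rep L (lbr L x ?y) a p = (\<Sum>g\<in>{g. ok L g}. inn L v c a g * der (rep L x) g p)
          - (\<Sum>g\<in>{g. ok L g}. rep L x a g * der (inn L v c) g p)"
        using p by (simp add: rep_lbr[OF xV yV] repy)
      \<comment> \<open>The terms in which \<open>c\<close> multiplies \<open>rep L x a\<close>
        occur in both sums and cancel.\<close>
      ultimately show "rep L (lbr L x ?y) a p = rep L ?z a p"
        by (simp add: sum_inn_der[OF x c a p] sum_der_inn[OF xV a p])
    qed
    then show ?thesis using z by simp
  qed
  then have "lbr L x ` im0 L \<subseteq> im0 L"
    unfolding im0_eq
    by (intro flinear_image_subset[OF lbr_linear]) (auto simp: mem_vertex_pairs)
  then show ?thesis using y by blast
qed

end

section \<open>Gluing two vertices\<close>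

text \<open>Composability is a condition on subwords of length 2, which is the length of the new
  relations.\<close>

lemma successively_iff_sublist: "successively P g \<longleftrightarrow> (\<forall>x y. sublist [x, y] g \<longrightarrow> P x y)"
proof (induction g)
  case (Cons a g)
  have "sublist [x, y] (a # g) \<longleftrightarrow> (x = a \<and> g \<noteq> [] \<and> hd g = y) \<or> sublist [x, y] g" for x y
    by (cases g) (auto simp: sublist_Cons_right)
  then show ?case by (auto simp: successively_Cons Cons.IH)
qed simp

lemma gl_eq_iff: "gl u w x = gl u w y \<longleftrightarrow> x = y \<or> (x \<in> {u, w} \<and> y \<in> {u, w})"
  by (auto simp: gl_def)

lemma glue_simps [simp]:
  "Es (glue L u w) = Es L" "sr (glue L u w) a = gl u w (sr L a)" "tg (glue L u w) a = gl u w (tg L a)"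
  "Vs (glue L u w) = gl u w ` Vs L"
  "Zs (glue L u w) = Zs L \<union> {[c, b] | b c. b \<in> Es L \<and> c \<in> Es L \<and> tg L c \<in> {u, w}
     \<and> sr L b \<in> {u, w} \<and> tg L c \<noteq> sr L b}"
  by (simp_all add: glue_def)

text \<open>The new relations of the glued algebra say exactly that a word is a path of the original
  quiver.\<close>
lemma ok_glue: "ok (glue L u w) g \<longleftrightarrow> ok L g"
proof -
  let ?N = "\<lambda>c b. b \<in> Es L \<and> c \<in> Es L \<and> tg L c \<in> {u, w} \<and> sr L b \<in> {u, w} \<and> tg L c \<noteq> sr L b"
  have 1: "successively (\<lambda>a b. tg L a = sr L b) g \<longleftrightarrow>
      successively (\<lambda>a b. gl u w (tg L a) = gl u w (sr L b)) g \<and> (\<forall>c b. ?N c b \<longrightarrow> \<not> sublist [c, b] g)"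
    if "set g \<subseteq> Es L"
  proof -
    have "x \<in> Es L" "y \<in> Es L" if "sublist [x, y] g" for x y
      using set_mono_sublist[OF that] \<open>set g \<subseteq> Es L\<close> by auto
    then show ?thesis unfolding successively_iff_sublist gl_eq_iff by blast
  qed
  have 2: "(\<forall>r\<in>Zs (glue L u w). \<not> sublist r g) \<longleftrightarrow>
      (\<forall>r\<in>Zs L. \<not> sublist r g) \<and> (\<forall>c b. ?N c b \<longrightarrow> \<not> sublist [c, b] g)"
    by auto
  show ?thesis
  proof (cases "set g \<subseteq> Es L")
    case True
    show ?thesis by (simp only: ok_def 1[OF True] 2 glue_simps(1-3) conj_ac)
  qed (simp add: ok_def)
qed

lemma walk_glue: "walk L v g v' \<Longrightarrow> walk (glue L u w) (gl u w v) g (gl u w v')"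
  by (induction g arbitrary: v) auto

lemma walk_unique:
  "walk L s g t \<Longrightarrow> walk L s' g t' \<Longrightarrow> g \<noteq> [] \<Longrightarrow> s = s' \<and> t = t'"
  using walk_hd walk_last by metis

text \<open>The parameter \<open>ground\<close> makes the coefficient field \<open>'k\<close>
  visible to the assumption \<open>char\<close>.\<close>

locale gluing = monomial A for A :: "('v,'a) mon" +
  fixes u w :: 'v and ground :: "'k::field itself"
  assumes uV: "u \<in> Vs A" and wV: "w \<in> Vs A" and uw: "u \<noteq> w"
    and minimal: "\<And>r r'. r \<in> Zs A \<Longrightarrow> r' \<in> Zs A \<Longrightarrow> sublist r r' \<Longrightarrow> r = r'"
    and char: "\<And>a m. a \<in> Es A \<Longrightarrow> 2 \<le> m \<Longrightarrow> sr A a = tg A a \<Longrightarrow> sr A a \<in> {u, w}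
      \<Longrightarrow> replicate m a \<in> Zs A \<Longrightarrow> of_nat m \<noteq> (0::'k)"
begin

abbreviation B where "B \<equiv> glue A u w"
abbreviation "KA \<equiv> (ker1 A :: (('v,'a) ppair \<Rightarrow> 'k) set)"
abbreviation "KB \<equiv> (ker1 B :: (('v,'a) ppair \<Rightarrow> 'k) set)"
abbreviation "IA \<equiv> (im0 A :: (('v,'a) ppair \<Rightarrow> 'k) set)"
abbreviation "IB \<equiv> (im0 B :: (('v,'a) ppair \<Rightarrow> 'k) set)"
abbreviation "ZS \<equiv> (Zsp A u w :: (('v,'a) ppair \<Rightarrow> 'k) set)"
abbreviation "ZSS \<equiv> (Zspp A u w :: (('v,'a) ppair \<Rightarrow> 'k) set)"
abbreviation "psi \<equiv> (psi1 A u w :: (('v,'a) ppair \<Rightarrow> 'k) \<Rightarrow> _)"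
abbreviation "inner \<equiv> (\<lambda>L v c. d0b L ((v, []), (v, c)) :: ('v,'a) ppair \<Rightarrow> 'k)"

text \<open>The basis of \<open>B\<close> stays finite because by \<open>ok_glue\<close> its words
  are those of \<open>A\<close>.\<close>

sublocale B: monomial B
proof
  show "finite (basis B)"
  proof (rule finite_subset)
    show "basis B \<subseteq> Vs B \<times> {g. ok A g}" by (auto simp: mem_basis ok_glue simp del: glue_simps)
  qed (simp add: finite_V finite_ok)
  show "walk B (sr B (hd r)) r (tg B (last r))" if "r \<in> Zs B" for r
    using that walk_glue[OF rel_walk] gl_eq_iff by fastforce
qed (use finite_E quiver rel_length in \<open>auto dest: subsetD[OF rel_arrows]\<close>)

section \<open>Transport of coefficients and brackets along \<open>psi1\<close>\<close>

lemma u_VB: "u \<in> Vs B" using uV uw by (auto simp: gl_def)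

lemma gl_u [simp]: "gl u w u = u" and gl_w [simp]: "gl u w w = u"
  by (simp_all add: gl_def)

text \<open>In an arrow pair the source of the path is that of the arrow. Gluing therefore never
  merges two such pairs, and each fibre in \<open>psi1\<close> has at most one element.\<close>

lemma psi_apply:
  assumes x: "x \<in> fspace (arrow_pairs A)"
  shows "psi x \<in> fspace (arrow_pairs B)" "rep B (psi x) = rep A x"
proof -
  let ?s = "\<lambda>z :: ('v,'a) ppair. (starp u w (fst z), starp u w (snd z))"
  have star: "?s (apath A a, (sr A a, g)) = (apath B a, (sr B a, g))" for a g
    by (simp add: starp_def apath_def)
  have "q \<in> arrow_pairs B" if nz: "psi x q \<noteq> 0" for q
  proof -
    obtain z where "z \<in> {z \<in> arrow_pairs A. ?s z = q}" "x z \<noteq> 0"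
      using nz unfolding psi1_def by (rule sum.not_neutral_contains_not_neutral)
    then obtain a g where a: "a \<in> Es A" "ok A g" "walk A (sr A a) g (tg A a)"
        and q: "q = ?s (apath A a, (sr A a, g))"
      by (auto simp: mem_arrow_pairs)
    then show ?thesis
      using walk_glue[OF a(3)] unfolding q star B.mem_arrow_pairs ok_glue by auto
  qed
  then show "psi x \<in> fspace (arrow_pairs B)" unfolding fspace_def by blast
  show "rep B (psi x) = rep A x"
  proof (intro ext)
    fix a :: 'a and g :: "'a list"
    let ?z = "(apath A a, (sr A a, g))"
    have "{z \<in> arrow_pairs A. ?s z = (apath B a, (sr B a, g))} = (if ?z \<in> arrow_pairs A then {?z} else {})"
      by (auto simp: mem_arrow_pairs starp_def apath_def)
    then have "rep B (psi x) a g = (if ?z \<in> arrow_pairs A then x ?z else 0)"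
      by (simp add: rep_def psi1_def)
    moreover have "?z \<notin> arrow_pairs A \<Longrightarrow> x ?z = 0" using x unfolding fspace_def by blast
    ultimately show "rep B (psi x) a g = rep A x a g" by (simp add: rep_def)
  qed
qed

lemma psi_linear: "flinear psi"
  by (rule flinearI) (simp_all add: psi1_def fun_eq_iff sum.distrib sum_distrib_left)

lemma pi1_linear: "flinear (pi1 A u w :: (('v,'a) ppair \<Rightarrow> 'k) \<Rightarrow> _)"
  by (rule flinearI) (simp_all add: pi1_def fun_eq_iff)

lemma psi_inj: "x \<in> fspace (arrow_pairs A) \<Longrightarrow> psi x = 0 \<Longrightarrow> x = 0"
proof (rule rep_eqI)
  assume x: "x \<in> fspace (arrow_pairs A)" "psi x = 0"
  show "rep A x a g = rep A 0 a g" for a g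
    using psi_apply(2)[OF x(1)] x(2) by (simp add: fun_eq_iff)
qed (auto simp: fspace_def)

text \<open>On coefficients the bracket is expressed by derivations and the words with
  \<open>ok\<close>, and these agree for \<open>A\<close> and \<open>B\<close>.\<close>

lemma psi_lbr:
  assumes x: "x \<in> fspace (arrow_pairs A)" and y: "y \<in> fspace (arrow_pairs A)"
  shows "psi (lbr A x y) = lbr B (psi x) (psi y)"
proof (rule B.rep_eqI)
  note xy = lbr_fspace[OF x y]
  show "psi (lbr A x y) \<in> fspace (arrow_pairs B)" by (rule psi_apply[OF xy])
  show "lbr B (psi x) (psi y) \<in> fspace (arrow_pairs B)"
    by (intro B.lbr_fspace psi_apply x y)
  show "rep B (psi (lbr A x y)) a p = rep B (lbr B (psi x) (psi y)) a p" for a p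
    by (simp only: psi_apply[OF xy] rep_lbr[OF x y] B.rep_lbr[OF psi_apply(1)[OF x] psi_apply(1)[OF y]]
        psi_apply[OF x] psi_apply[OF y] ok_glue)
qed

text \<open>Where the hypothesis on the characteristic enters: a power of the loop is a relation, and
  the coefficient of the next lower power in its derivative is m times X a [].\<close>
lemma loop_zero:
  fixes X :: "'a \<Rightarrow> 'a list \<Rightarrow> 'k"
  assumes a: "a \<in> Es A" "sr A a = tg A a" "sr A a \<in> {u, w}"
    and X: "\<And>r p. r \<in> Zs A \<Longrightarrow> ok A p \<Longrightarrow> der X r p = 0"
  shows "X a [] = 0"
proof -
  have walk: "walk A (sr A a) (replicate k a) (sr A a)" for k
    using a(2) by (induction k) auto
  have ok: "ok A (replicate k a) \<longleftrightarrow> (\<forall>r\<in>Zs A. \<not> sublist r (replicate k a))" for k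
    using a(1) walk_successively[OF walk[of k]] by (auto simp: ok_def)
  \<comment> \<open>Otherwise all powers of the loop would be basis words, infinitely many.\<close>
  have "\<not> range (\<lambda>k. replicate k a) \<subseteq> {g. ok A g}"
  proof
    assume "range (\<lambda>k. replicate k a) \<subseteq> {g. ok A g}"
    then have "finite (range (\<lambda>k. replicate k a))" using finite_ok finite_subset by blast
    moreover have "inj (\<lambda>k. replicate k a)" by (rule injI) (metis length_replicate)
    ultimately show False using finite_imageD infinite_UNIV_nat by blast
  qed
  then obtain k r where r: "r \<in> Zs A" "sublist r (replicate k a)" using ok by blast
  then have "r = replicate (length r) a"
    using set_mono_sublist[OF r(2)] by (intro replicate_length_same[symmetric]) auto
  then obtain n where n: "r = replicate (Suc n) a" "2 \<le> Suc n"
    using rel_length[OF r(1)] by (metis Suc_le_D numeral_2_eq_2)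
  \<comment> \<open>By minimality a proper subword of the relation \<open>r\<close> contains no
    relation.\<close>
  have "ok A (replicate n a)"
    unfolding ok
  proof (intro ballI notI)
    fix r' assume r': "r' \<in> Zs A" "sublist r' (replicate n a)"
    have "sublist (replicate n a) r" unfolding n by (simp add: sublist_Cons_right)
    then have "r' = r" using minimal[OF r'(1) r(1)] r'(2) sublist_order.order.trans by blast
    then show False using sublist_length_le[OF r'(2)] n by simp
  qed
  then have "der X r (replicate n a) = 0" by (rule X[OF r(1)])
  moreover have "der X (replicate (Suc n) a) (replicate n a) = of_nat (Suc n) * X a []" for n
  proof (induction n)
    case (Suc n)
    have "right_mult (replicate (Suc n) a) (X a) (replicate (Suc n) a) = X a []"
      using right_mult_append[of "replicate (Suc n) a" "X a" "[]"] by simp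
    moreover have "left_mult [a] (der X (replicate (Suc n) a)) (replicate (Suc n) a)
        = der X (replicate (Suc n) a) (replicate n a)"
      using left_mult_append[of "[a]" "der X (replicate (Suc n) a)" "replicate n a"] by simp
    ultimately show ?case
      using Suc.IH by (simp add: replicate_Suc[of "Suc n"] algebra_simps del: replicate_Suc)
  qed simp
  moreover have "of_nat (Suc n) \<noteq> (0::'k)" using char a n r(1) by metis
  ultimately show ?thesis unfolding n(1) by simp
qed

section \<open>The kernel of \<open>d1\<close> for the glued algebra\<close>

lemma ker1_A_loop: "x \<in> KA \<Longrightarrow> a \<in> Es A \<Longrightarrow> sr A a = tg A a \<Longrightarrow> sr A a \<in> {u, w} \<Longrightarrow> rep A x a [] = 0"
  by (rule loop_zero) (auto simp: mem_ker1_iff)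

text \<open>The new relations \<open>[c, b]\<close> are the ones to be checked. A nonempty parallel
  path put in place of \<open>c\<close> or \<open>b\<close> leaves two distinct vertices at the
  junction, so the result is no path of \<open>A\<close>; the empty path requires a loop at
  \<open>u\<close> or \<open>w\<close>, where the coefficient vanishes.\<close>

lemma psi_ker1:
  assumes x: "x \<in> KA"
  shows "psi x \<in> KB"
proof -
  have xV: "x \<in> fspace (arrow_pairs A)" using x by (simp add: ker1_def)
  have "der (rep A x) [c, b] p = 0"
    if cb: "b \<in> Es A" "c \<in> Es A" "tg A c \<in> {u, w}" "sr A b \<in> {u, w}" "tg A c \<noteq> sr A b"
      and p: "ok A p" for c b p
  proof (rule ccontr)
    assume "der (rep A x) [c, b] p \<noteq> 0"
    then obtain r1 a r2 g where r: "[c, b] = r1 @ a # r2" "p = r1 @ g @ r2" "rep A x a g \<noteq> 0"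
      by (rule der_nonzeroE)
    have g: "walk A (sr A a) g (tg A a)" using rep_support[OF xV r(3)] by simp
    consider "r1 = []" "a = c" "r2 = [b]" | "r1 = [c]" "a = b" "r2 = []"
      using r(1) by (cases r1) (auto simp: Cons_eq_append_conv)
    then show False
    proof cases
      case 1
      show False
      proof (cases "g = []")
        case True
        then show False using g r(3) ker1_A_loop[OF x] cb 1 by simp
      next
        case False
        then have "tg A (last g) = tg A c" using walk_last[OF g] 1 by simp
        moreover have "tg A (last g) = sr A b"
          using p False unfolding r(2) 1 by (simp add: ok_def successively_append_iff)
        ultimately show False using cb by simp
      qed
    next
      case 2
      show False
      proof (cases "g = []")
        case True
        then show False using g r(3) ker1_A_loop[OF x] cb 2 by simp
      next
        case False
        then have "sr A (hd g) = sr A b" using walk_hd[OF g] 2 by simp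
        moreover have "tg A c = sr A (hd g)"
          using p False unfolding r(2) 2 by (simp add: ok_def successively_Cons)
        ultimately show False using cb by simp
      qed
    qed
  qed
  then show ?thesis
    using x psi_apply[OF xV] by (auto simp: B.mem_ker1_iff mem_ker1_iff ok_glue)
qed

text \<open>Being special mostly means that \<open>g\<close> is not parallel to \<open>a\<close> in
  \<open>A\<close>. The exception is a loop at one glued vertex together with the trivial path at
  the other: its image is also the image of a parallel pair.\<close>

lemma mem_spp_iff:
  "q \<in> spp_pairs A u w \<longleftrightarrow> (\<exists>a g. a \<in> Es A \<and> ok A g \<and> walk B (sr B a) g (tg B a)
     \<and> q = (apath B a, (sr B a, g))
     \<and> (walk A (sr A a) g (tg A a) \<longrightarrow> g = [] \<and> sr A a = tg A a \<and> sr A a \<in> {u, w}))"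
proof
  assume "q \<in> spp_pairs A u w"
  then obtain b s g where b: "b \<in> Es A" "(s, g) \<in> basis A"
      and q: "q = (apath B b, starp u w (s, g))" "q \<in> arrow_pairs B"
      and np: "\<not> parallel A (apath A b) (s, g)"
    unfolding spp_pairs_def by (auto simp: split_paired_Ex)
  obtain a h where a: "a \<in> Es A" "ok A h" "walk B (sr B a) h (tg B a)" "q = (apath B a, (sr B a, h))"
    using q(2) unfolding B.mem_arrow_pairs ok_glue glue_simps(1) by blast
  have ab: "a = b" "h = g" and gl: "gl u w s = gl u w (sr A a)"
    using q(1) a(4) by (auto simp: apath_def starp_def)
  have np': "\<not> (s = sr A a \<and> ptgt A (s, g) = tg A a)"
    using np by (auto simp: parallel_def apath_def ptgt_def ab)
  have "g = [] \<and> sr A a = tg A a \<and> sr A a \<in> {u, w}" if wk: "walk A (sr A a) g (tg A a)"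
  proof (cases "g = []")
    case True
    then show ?thesis using wk np' gl by (auto simp: gl_eq_iff ptgt_def)
  next
    case False
    then have "s = sr A a" using walk_hd[OF wk] b(2) by (simp add: mem_basis)
    then show ?thesis using np' wk by (simp add: walk_iff)
  qed
  then show "\<exists>a g. a \<in> Es A \<and> ok A g \<and> walk B (sr B a) g (tg B a)
     \<and> q = (apath B a, (sr B a, g))
     \<and> (walk A (sr A a) g (tg A a) \<longrightarrow> g = [] \<and> sr A a = tg A a \<and> sr A a \<in> {u, w})"
    using a ab by blast
next
  assume "\<exists>a g. a \<in> Es A \<and> ok A g \<and> walk B (sr B a) g (tg B a)
     \<and> q = (apath B a, (sr B a, g))
     \<and> (walk A (sr A a) g (tg A a) \<longrightarrow> g = [] \<and> sr A a = tg A a \<and> sr A a \<in> {u, w})"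
  then obtain a g where a: "a \<in> Es A" "ok A g" "walk B (sr B a) g (tg B a)"
      and q: "q = (apath B a, (sr B a, g))"
      and or: "walk A (sr A a) g (tg A a) \<longrightarrow> g = [] \<and> sr A a = tg A a \<and> sr A a \<in> {u, w}"
    by blast
  have qB: "q \<in> arrow_pairs B" unfolding B.mem_arrow_pairs ok_glue using a q by auto
  have *: "q \<in> spp_pairs A u w"
    if "(s, g) \<in> basis A" "gl u w s = gl u w (sr A a)" "s \<noteq> sr A a \<or> ptgt A (s, g) \<noteq> tg A a"
      "sr A a \<in> {u, w} \<or> tg A a \<in> {u, w}" for s
  proof -
    have "q = (apath B a, starp u w (s, g))" using q that by (simp add: starp_def)
    moreover have "\<not> parallel A (apath A a) (s, g)"
      using that by (auto simp: parallel_def apath_def ptgt_def)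
    ultimately show ?thesis unfolding spp_pairs_def using a(1) that qB by blast
  qed
  show "q \<in> spp_pairs A u w"
  proof (cases "g = []")
    case True
    then have gl: "gl u w (sr A a) = gl u w (tg A a)" using a(3) by simp
    show ?thesis
    proof (cases "sr A a = tg A a")
      case True
      then have "sr A a \<in> {u, w}" using or \<open>g = []\<close> by simp
      \<comment> \<open>The trivial path at the other glued vertex is not parallel to the loop, but
        has the same image as the trivial path at the vertex of the loop.\<close>
      then show ?thesis
        using *[of "if sr A a = u then w else u"] uV wV uw ok_Nil \<open>g = []\<close>
        by (auto simp: mem_basis gl_def split: if_split_asm)
    next
      case False
      then show ?thesis
        using *[of "sr A a"] gl quiver(1)[OF a(1)] ok_Nil \<open>g = []\<close>
        by (auto simp: mem_basis gl_eq_iff ptgt_def)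
    qed
  next
    case False
    have wk: "walk A (sr A (hd g)) g (tg A (last g))" by (rule ok_walk[OF a(2) False])
    have "gl u w (sr A (hd g)) = gl u w (sr A a)" "gl u w (tg A (last g)) = gl u w (tg A a)"
      using walk_unique[OF walk_glue[OF wk] a(3) False] by simp_all
    moreover have "sr A (hd g) \<noteq> sr A a \<or> tg A (last g) \<noteq> tg A a" using wk or False by auto
    moreover have "ptgt A (sr A (hd g), g) = tg A (last g)" using wk by (simp add: walk_iff)
    ultimately show ?thesis
      using *[of "sr A (hd g)"] basis_of_ok[OF a(2) False] by (auto simp: gl_eq_iff)
  qed
qed

lemma Zspp_eq: "ZSS = KB \<inter> fspace (spp_pairs A u w)"
proof -
  have "spp_pairs A u w \<subseteq> arrow_pairs B" by (auto simp: spp_pairs_def)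
  then have "finite (spp_pairs A u w)" using B.finite_arrow_pairs finite_subset by blast
  then show ?thesis by (simp only: Zspp_def fspan_eq span_bv)
qed

lemma subspace_Zspp: "fn.subspace ZSS"
  unfolding Zspp_eq by (intro fn.subspace_inter B.subspace_ker1 subspace_fspace)

text \<open>A special pair has a word parallel to its arrow in \<open>A\<close> only for a loop with
  the empty word, and there kernel elements have coefficient 0.\<close>

lemma pi1_psi:
  assumes x: "x \<in> KA"
  shows "pi1 A u w (psi x) = 0"
proof
  fix q
  have xV: "x \<in> fspace (arrow_pairs A)" using x by (simp add: ker1_def)
  have "psi x q = 0" if "q \<in> spp_pairs A u w"
  proof (rule ccontr)
    assume nz: "psi x q \<noteq> 0"
    obtain a g where a: "a \<in> Es A" "q = (apath B a, (sr B a, g))"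
        and or: "walk A (sr A a) g (tg A a) \<longrightarrow> g = [] \<and> sr A a = tg A a \<and> sr A a \<in> {u, w}"
      using \<open>q \<in> spp_pairs A u w\<close> unfolding mem_spp_iff by blast
    have rep: "rep A x a g \<noteq> 0" using nz psi_apply(2)[OF xV] by (metis a(2) rep_def)
    then have "g = [] \<and> sr A a = tg A a \<and> sr A a \<in> {u, w}" using or rep_support[OF xV] by blast
    then show False using rep ker1_A_loop[OF x a(1)] by blast
  qed
  then show "pi1 A u w (psi x) q = 0 q" by (simp add: pi1_def)
qed

lemma pi1_Zspp: "z \<in> ZSS \<Longrightarrow> pi1 A u w z = z"
  by (auto simp: Zspp_eq fspace_def pi1_def fun_eq_iff)

lemma ker1_B_decomp:
  assumes y: "y \<in> KB"
  shows "\<exists>x\<in>KA. \<exists>z\<in>ZSS. y = psi x + z"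
proof -
  let ?X = "rep B y"
  \<comment> \<open>The coefficients at words parallel to the arrow in \<open>A\<close>;
    \<open>?X2\<close> collects the remaining ones.\<close>
  let ?X1 = "\<lambda>a g. if walk A (sr A a) g (tg A a) then ?X a g else 0"
  let ?X2 = "\<lambda>a g. if walk A (sr A a) g (tg A a) then 0 else ?X a g"
  have yV: "y \<in> fspace (arrow_pairs B)" using y by (simp add: ker1_def)
  have X: "(\<lambda>a g. ?X1 a g + ?X2 a g) = ?X" by (auto simp: fun_eq_iff)
  have supp: "?X a g \<noteq> 0 \<Longrightarrow> a \<in> Es A \<and> ok A g" for a g
    using B.rep_support[OF yV, of a g] by (simp add: ok_glue)
  define x where "x = emb A ?X1"
  have xV: "x \<in> fspace (arrow_pairs A)"
    unfolding x_def using supp by (intro emb_fspace) (auto split: if_split_asm)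
  have "der ?X1 r p = 0" if r: "r \<in> Zs A" and p: "ok A p" for r p
  \<comment> \<open>At words with the end points of \<open>r\<close> the part \<open>?X2\<close>
    contributes nothing, at all other words \<open>?X1\<close> contributes nothing.\<close>
  proof (cases "walk A (sr A (hd r)) p (tg A (last r))")
    case True
    have "der ?X2 r p = 0"
      by (rule der_not_walk[OF _ rel_walk[OF r] True]) (auto split: if_split_asm)
    moreover have "der ?X r p = 0" using y r p by (simp add: B.mem_ker1_iff ok_glue)
    moreover have "der ?X r p = der ?X1 r p + der ?X2 r p"
      using der_add[of ?X1 ?X2 r p] unfolding X .
    ultimately show ?thesis by simp
  next
    case False
    have "walk A (sr A a) g (tg A a)" if "?X1 a g \<noteq> 0" for a g
      using that by (simp split: if_split_asm)
    then show ?thesis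
      using der_walk[where X = ?X1 and L = A, OF _ rel_walk[OF r], of p] False by blast
  qed
  then have xK: "x \<in> KA" unfolding mem_ker1_iff using xV by (simp add: x_def)
  define z where "z = y - psi x"
  have "z \<in> KB" unfolding z_def by (intro fn.subspace_diff[OF B.subspace_ker1] y psi_ker1 xK)
  moreover have "z \<in> fspace (spp_pairs A u w)"
  proof -
    have "q \<in> spp_pairs A u w" if nz: "z q \<noteq> 0" for q
    proof -
      have "q \<in> arrow_pairs B" using \<open>z \<in> KB\<close> nz unfolding ker1_def fspace_def by blast
      then obtain a g where a: "a \<in> Es A" "ok A g" "walk B (sr B a) g (tg B a)"
          "q = (apath B a, (sr B a, g))"
        unfolding B.mem_arrow_pairs ok_glue glue_simps(1) by blast
      have "rep B z a g \<noteq> 0" using nz by (simp only: a(4) rep_def not_False_eq_True)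
      then have "?X a g - ?X1 a g \<noteq> 0"
        unfolding z_def rep_diff psi_apply(2)[OF xV] by (simp add: x_def)
      then have "\<not> walk A (sr A a) g (tg A a)" by (auto split: if_split_asm)
      then show ?thesis unfolding mem_spp_iff using a by blast
    qed
    then show ?thesis unfolding fspace_def by blast
  qed
  moreover have "y = psi x + z" by (simp add: z_def)
  ultimately show ?thesis using xK unfolding Zspp_eq by blast
qed

section \<open>Special paths and their inner derivations\<close>

definition special :: "'a list \<Rightarrow> bool" where
  "special c \<longleftrightarrow> ok A c \<and> (walk A u c w \<or> walk A w c u)"

lemma special_B: "special c \<Longrightarrow> ok B c \<and> walk B u c u"
  using walk_glue[of A u c w u w] walk_glue[of A w c u u w] by (auto simp: special_def ok_glue)

text \<open>The two generating sets differ at most by the zero vector, so their spans agree.\<close>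

lemma Zsp_eq: "ZS = fn.span {inner B u c | c. special c}"
proof -
  let ?h = "\<lambda>p :: ('v,'a) path. d0 B (bv ((u, []), starp u w p)) :: ('v,'a) ppair \<Rightarrow> 'k"
  let ?P = "\<lambda>p. p \<in> basis A \<and> ((fst p = u \<and> ptgt A p = w) \<or> (fst p = w \<and> ptgt A p = u))"
  have h: "?h p = inner B u (snd p)" "special (snd p)" if "?P p" for p
  proof -
    obtain s c where p: "p = (s, c)" by (rule prod.exhaust)
    have "ok A c" "(s = u \<and> walk A u c w) \<or> (s = w \<and> walk A w c u)"
      using that basis_ptgt_iff[of s c] unfolding p by auto
    then show sp: "special (snd p)" by (auto simp: special_def p)
    have "starp u w p = (u, c)" using that by (auto simp: p starp_def gl_def)
    moreover have sB: "ok B c" "walk B u c u" using special_B[OF sp] p by simp_all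
    have "((u, []), (u, c)) \<in> vertex_pairs B"
      unfolding B.mem_vertex_pairs by (intro exI[of _ u] exI[of _ c] conjI refl u_VB sB)
    ultimately show "?h p = inner B u (snd p)" by (simp add: B.d0_bv p)
  qed
  have h': "\<exists>p. ?P p \<and> snd p = c" if spc: "special c" for c
  proof -
    obtain s t where "walk A s c t" "(s = u \<and> t = w) \<or> (s = w \<and> t = u)" "ok A c"
      using spc by (auto simp: special_def)
    then have "?P (s, c)" using basis_ptgt_iff[of s c t] uV wV by auto
    then show ?thesis by (intro exI[of _ "(s, c)"]) simp
  qed
  have 1: "{?h p | p. ?P p \<and> ?h p \<noteq> 0} \<subseteq> {inner B u c | c. special c}"
  proof
    fix x assume "x \<in> {?h p | p. ?P p \<and> ?h p \<noteq> 0}"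
    then obtain p where "p \<in> basis A" "(fst p = u \<and> ptgt A p = w) \<or> (fst p = w \<and> ptgt A p = u)"
        "x = ?h p"
      by (elim CollectE exE conjE)
    then show "x \<in> {inner B u c | c. special c}" using h[of p] by (intro CollectI exI[of _ "snd p"]) simp
  qed
  have 2: "{inner B u c | c. special c} \<subseteq> insert 0 {?h p | p. ?P p \<and> ?h p \<noteq> 0}"
  proof
    fix x assume "x \<in> {inner B u c | c. special c}"
    then obtain c where "special c" "x = inner B u c" by (elim CollectE exE conjE)
    moreover have "\<exists>p. ?P p \<and> snd p = c" by (rule h'[OF \<open>special c\<close>])
    then obtain p where p: "p \<in> basis A" "(fst p = u \<and> ptgt A p = w) \<or> (fst p = w \<and> ptgt A p = u)"
        "snd p = c"
      by (elim exE conjE)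
    ultimately have x: "x = ?h p" using h(1)[of p] by simp
    show "x \<in> insert 0 {?h p | p. ?P p \<and> ?h p \<noteq> 0}"
    proof (cases "x = 0")
      case False
      then show ?thesis using p(1,2) unfolding x by (intro insertI2 CollectI exI[of _ p]) simp
    qed simp
  qed
  have "fn.span {?h p | p. ?P p \<and> ?h p \<noteq> 0} = fn.span {inner B u c | c. special c}"
    using fn.span_mono[OF 1] fn.span_mono[OF 2] unfolding fn.span_insert_0
    by (rule subset_antisym)
  moreover have "ZS = fn.span {?h p | p. ?P p \<and> ?h p \<noteq> 0}"
    unfolding Zsp_def fspan_eq zero_fun_def by (simp only: conj_assoc)
  ultimately show ?thesis by simp
qed

lemma subspace_Zsp: "fn.subspace ZS"
  unfolding Zsp_eq by (rule fn.subspace_span)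

lemma inner_Zsp: "special c \<Longrightarrow> inner B u c \<in> ZS"
  unfolding Zsp_eq by (intro fn.span_base CollectI exI[of _ c]) simp

lemma Zsp_subset:
  assumes "fn.subspace W" "\<And>c. special c \<Longrightarrow> inner B u c \<in> W"
  shows "ZS \<subseteq> W"
  unfolding Zsp_eq
proof (rule fn.span_minimal[OF _ assms(1)])
  show "{inner B u c | c. special c} \<subseteq> W"
    using assms(2) by (intro subsetI) (elim CollectE exE conjE, simp)
qed

text \<open>In \<open>B\<close> a special path is a cycle at the glued vertex.\<close>

lemma Zsp_im0: "ZS \<subseteq> IB"
  using special_B u_VB by (intro Zsp_subset B.subspace_im0 B.d0b_im0) auto

text \<open>A special path joins different vertices of \<open>A\<close>. So \<open>c @ [a]\<close>
  and \<open>a # c\<close> cannot be parallel to \<open>a\<close> there, as \<open>c\<close> would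
  have to be closed.\<close>

lemma Zsp_Zspp: "ZS \<subseteq> ZSS"
proof (rule Zsp_subset[OF subspace_Zspp])
  fix c assume c: "special c"
  let ?y = "inner B u c"
  have cB: "ok B c" "walk B u c u" using special_B[OF c] by auto
  have yK: "?y \<in> KB" using B.d0b_im0[OF u_VB cB] B.im0_ker1 by blast
  have "q \<in> spp_pairs A u w" if nz: "?y q \<noteq> 0" for q
  proof -
    have "q \<in> arrow_pairs B" using B.d0b_fspace[OF u_VB cB] nz unfolding fspace_def by blast
    then obtain a g where a: "a \<in> Es A" "ok A g" "walk B (sr B a) g (tg B a)"
        "q = (apath B a, (sr B a, g))"
      unfolding B.mem_arrow_pairs ok_glue glue_simps(1) by blast
    have "rep B ?y a g \<noteq> 0" using nz by (simp only: a(4) rep_def not_False_eq_True)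
    then have "inn B u c a g \<noteq> (0::'k)" by (simp only: B.rep_d0b[OF u_VB cB] not_False_eq_True)
    then have g: "g = c @ [a] \<or> g = a # c" by (auto simp: inn_def split: if_split_asm)
    obtain s t where st: "walk A s c t" "s \<noteq> t" "c \<noteq> []"
      using c uw by (cases c) (auto simp: special_def)
    have "\<not> walk A (sr A a) g (tg A a)"
    proof
      assume wk: "walk A (sr A a) g (tg A a)"
      have "\<exists>m. walk A m c m" using wk g by (auto simp: walk_append)
      then show False using walk_unique[OF st(1) _ st(3)] st(2) by blast
    qed
    then show ?thesis unfolding mem_spp_iff using a by blast
  qed
  then show "?y \<in> ZSS" unfolding Zspp_eq fspace_def using yK by blast
qed

lemma Zspp_ker1: "ZSS \<subseteq> KB"
  by (simp add: Zspp_eq)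

sublocale D: split_diagram KA IA KB ZS ZSS psi "pi1 A u w"
proof (rule split_diagram.intro)
  show "x = 0" if "x \<in> KA" "psi x = 0" for x
    using psi_inj[of x] that by (simp add: ker1_def)
  show "psi x \<in> KB" if "x \<in> KA" for x by (rule psi_ker1[OF that])
  show "pi1 A u w (psi x) = 0" if "x \<in> KA" for x by (rule pi1_psi[OF that])
  show "pi1 A u w z = z" if "z \<in> ZSS" for z by (rule pi1_Zspp[OF that])
  show "\<exists>x\<in>KA. \<exists>z\<in>ZSS. y = psi x + z" if "y \<in> KB" for y by (rule ker1_B_decomp[OF that])
qed (rule subspace_ker1 subspace_im0 B.subspace_ker1 subspace_Zsp subspace_Zspp im0_ker1 Zsp_Zspp
    Zspp_ker1 psi_linear pi1_linear)+

section \<open>Comparison of \<open>Y\<close> with the image of \<open>d0\<close> for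
  \<open>B\<close>\<close>

lemma Yspace_eq: "Yspace A u w = D.Y"
proof -
  have "Yspace A u w = {x + b | x b. x \<in> psi ` IA \<and> b \<in> ZS}"
    unfolding Yspace_def plus_fun_def by (rule refl)
  also have "\<dots> = D.Y"
  proof (intro equalityI subsetI)
    fix y assume "y \<in> {x + b | x b. x \<in> psi ` IA \<and> b \<in> ZS}"
    then obtain a b where "a \<in> IA" "b \<in> ZS" "y = psi a + b" by (elim CollectE exE conjE imageE) simp
    then show "y \<in> D.Y" using D.YI by simp
  next
    fix y assume "y \<in> D.Y"
    then obtain a b where "a \<in> IA" "b \<in> ZS" "y = psi a + b" by (rule D.YE)
    then show "y \<in> {x + b | x b. x \<in> psi ` IA \<and> b \<in> ZS}"
      by (intro CollectI exI[of _ "psi a"] exI[of _ b]) simp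
  qed
  finally show ?thesis .
qed

lemma psi_d0b:
  assumes v: "v \<in> Vs A" and c: "ok A c" "walk A v c v"
  shows "psi (inner A v c) \<in> fspace (arrow_pairs B)" "rep B (psi (inner A v c)) a g = inn A v c a g"
  using psi_apply[OF d0b_fspace[OF v c]] by (simp_all add: rep_d0b[OF v c])

lemma psi_inner:
  assumes v: "v \<in> Vs A" and c: "ok A c" "walk A v c v"
    and eq: "\<And>a g. a \<in> Es A \<Longrightarrow> ok A g \<Longrightarrow> inn B (gl u w v) c a g = (inn A v c a g :: 'k)"
  shows "psi (inner A v c) = inner B (gl u w v) c"
proof -
  have B: "gl u w v \<in> Vs B" "ok B c" "walk B (gl u w v) c (gl u w v)"
    using v c walk_glue[OF c(2)] by (auto simp: ok_glue)
  show ?thesis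
    by (rule B.rep_eqI[OF psi_d0b(1)[OF v c] B.d0b_fspace[OF B]])
      (simp add: psi_d0b[OF v c] B.rep_d0b[OF B] eq ok_glue)
qed

text \<open>Gluing creates no new nonzero product with a nontrivial path, since basis words of
  \<open>B\<close> are basis words of \<open>A\<close>. Hence the arrows that have a nonzero product
  with \<open>c\<close> in \<open>B\<close> already meet it at \<open>v\<close>.\<close>

lemma psi_inner_cycle:
  assumes v: "v \<in> Vs A" and c: "ok A c" "walk A v c v" "c \<noteq> []"
  shows "psi (inner A v c) = inner B (gl u w v) c"
proof (rule psi_inner[OF v c(1,2)])
  fix a g assume "a \<in> Es A" "ok A g"
  moreover have "sr A a = v" if "ok A (c @ [a])"
    using that walk_last[OF c(2,3)] c(3) by (auto simp: ok_def successively_append_iff)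
  moreover have "tg A a = v" if "ok A (a # c)"
    using that walk_hd[OF c(2,3)] c(3) by (auto simp: ok_def successively_Cons)
  ultimately show "inn B (gl u w v) c a g = (inn A v c a g :: 'k)"
    by (auto simp: inn_def ok_glue)
qed

lemma psi_inner_vertex:
  assumes v: "v \<in> Vs A" "v \<noteq> u" "v \<noteq> w"
  shows "psi (inner A v []) = inner B v []"
proof -
  have gl: "gl u w x = v \<longleftrightarrow> x = v" for x using v by (auto simp: gl_def)
  have v': "gl u w v = v" using v by (simp add: gl_def)
  have "inn B (gl u w v) [] a g = (inn A v [] a g :: 'k)" for a g
    unfolding v' by (simp add: inn_def ok_glue gl)
  then have "psi (inner A v []) = inner B (gl u w v) []"
    using v ok_Nil by (intro psi_inner) auto
  then show ?thesis by (simp only: v')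
qed

abbreviation "y0 \<equiv> psi (inner A u [])"

text \<open>An arrow starts at the glued vertex iff it starts at \<open>u\<close> or at
  \<open>w\<close>, and these cases exclude each other; likewise for targets.\<close>

lemma inner_glued_vertex: "inner B u [] = y0 + psi (inner A w [])"
proof -
  have B: "ok B []" "walk B u [] u" using ok_Nil by (auto simp: ok_glue)
  have A: "ok A []" "walk A u [] u" "walk A w [] w" using ok_Nil by auto
  show ?thesis
  proof (rule B.rep_eqI[OF B.d0b_fspace[OF u_VB B]])
    show "y0 + psi (inner A w []) \<in> fspace (arrow_pairs B)"
      by (intro fn.subspace_add[OF subspace_fspace] psi_d0b uV wV A)
    have "gl u w x = u \<longleftrightarrow> x = u \<or> x = w" for x by (auto simp: gl_def)
    then show "rep B (inner B u []) a g = rep B (y0 + psi (inner A w [])) a g" for a g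
      using uw by (auto simp: B.rep_d0b[OF u_VB B] psi_d0b[OF uV A(1,2)] psi_d0b[OF wV A(1,3)]
        inn_def ok_glue)
  qed
qed

lemma y0_Y: "y0 \<in> D.Y"
  using uV ok_Nil by (intro D.psi_Y d0b_im0) auto

text \<open>A nontrivial cycle of \<open>B\<close> is either a cycle of \<open>A\<close>,
  contributing to the image of \<open>psi\<close>, or a special path, contributing to
  \<open>ZS\<close>.\<close>

lemma im0_B_Y: "IB \<subseteq> D.Y"
proof (rule B.im0_subset[OF D.subspace_Y])
  fix v c assume v: "v \<in> Vs B" and c: "ok B c" "walk B v c v"
  have cA: "ok A c" using c(1) by (simp add: ok_glue)
  show "inner B v c \<in> D.Y"
  proof (cases "c = []")
    case True
    have "psi (inner A x []) \<in> D.Y" if "x \<in> Vs A" for x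
      using that ok_Nil by (intro D.psi_Y d0b_im0) auto
    note psiY = this
    show ?thesis
    proof (cases "v = u")
      case True
      then show ?thesis
        unfolding \<open>c = []\<close> \<open>v = u\<close> inner_glued_vertex
        by (intro fn.subspace_add[OF D.subspace_Y] psiY uV wV)
    next
      case False
      then have "v \<in> Vs A" "v \<noteq> w" using v uw by (auto simp: gl_def split: if_split_asm)
      then show ?thesis
        using psiY[of v] psi_inner_vertex[of v] False \<open>c = []\<close> by simp
    qed
  next
    case False
    let ?s = "sr A (hd c)" and ?t = "tg A (last c)"
    have wk: "walk A ?s c ?t" by (rule ok_walk[OF cA False])
    have s: "?s \<in> Vs A" using cA False quiver(1) hd_in_set by (fastforce simp: ok_def)
    have gl: "gl u w ?s = v" "gl u w ?t = v"
      using walk_unique[OF walk_glue[OF wk] c(2) False] by auto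
    show ?thesis
    proof (cases "?s = ?t")
      case True
      then have "walk A ?s c ?s" using wk by simp
      then have "psi (inner A ?s c) = inner B v c" "inner A ?s c \<in> IA"
        using psi_inner_cycle[OF s cA _ False] d0b_im0[OF s cA] gl by auto
      then show ?thesis using D.psi_Y by metis
    next
      case False
      then have "?s \<in> {u, w}" "?t \<in> {u, w}" using gl by (auto simp: gl_def split: if_split_asm)
      moreover from this have "v = u" using gl by (auto simp: gl_def)
      ultimately have "special c" "v = u" using False wk cA by (auto simp: special_def)
      then show ?thesis using inner_Zsp D.ZS_Y by simp
    qed
  qed
qed

text \<open>Apart from the trivial paths at \<open>u\<close> and \<open>w\<close>, all generators of
  \<open>Y\<close> come from inner derivations of \<open>B\<close>. The images of these two add up
  to an element of \<open>IB\<close>, so \<open>y0\<close> accounts for both.\<close>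

lemma Y_span: "D.Y \<subseteq> fn.span (insert y0 IB)"
proof -
  let ?W = "fn.span (insert y0 IB)"
  have IB: "x \<in> ?W" if "x \<in> IB" for x using that by (simp add: fn.span_base)
  have y0: "y0 \<in> ?W" by (simp add: fn.span_base)
  have "psi (inner A v c) \<in> ?W" if v: "v \<in> Vs A" and c: "ok A c" "walk A v c v" for v c
  proof -
    have B: "gl u w v \<in> Vs B" "ok B c" "walk B (gl u w v) c (gl u w v)"
      using v c walk_glue[OF c(2)] by (auto simp: ok_glue)
    have inB: "inner B (gl u w v) c \<in> ?W" by (rule IB[OF B.d0b_im0[OF B]])
    consider "c \<noteq> []" | "c = []" "v \<noteq> u" "v \<noteq> w" | "c = []" "v = u" | "c = []" "v = w" by blast
    then show ?thesis
    proof cases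
      case 1
      then show ?thesis using inB psi_inner_cycle[OF v c] by simp
    next
      case 2
      then show ?thesis using inB psi_inner_vertex[OF v] by (simp add: gl_def)
    next
      case 3
      then show ?thesis using y0 by simp
    next
      case 4
      then have "psi (inner A v c) = inner B (gl u w v) c - y0"
        by (simp add: inner_glued_vertex)
      then show ?thesis using fn.span_diff[OF inB y0] by simp
    qed
  qed
  then have "psi ` IA \<subseteq> ?W"
    unfolding im0_eq
    by (intro flinear_image_subset[OF psi_linear]) (auto simp: mem_vertex_pairs)
  moreover have "ZS \<subseteq> ?W" using Zsp_im0 IB by blast
  ultimately have sub: "psi a \<in> ?W" "b \<in> ?W" if "a \<in> IA" "b \<in> ZS" for a b
    using that by auto
  show ?thesis
  proof
    fix y assume "y \<in> D.Y"
    then obtain a b where "a \<in> IA" "b \<in> ZS" "y = psi a + b" by (rule D.YE)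
    then show "y \<in> ?W" using sub[of a b] by (simp add: fn.span_add)
  qed
qed

lemma Y_codim:
  assumes "z \<in> D.Y"
  shows "\<exists>k. z - scal k y0 \<in> IB"
proof -
  have "z \<in> fn.span (insert y0 IB)" using Y_span assms by blast
  then obtain k where "z - scal k y0 \<in> fn.span IB" unfolding fn.span_breakdown_eq by blast
  moreover have "fn.span IB = IB" using B.subspace_im0 by (simp only: fn.span_eq_iff)
  ultimately show ?thesis by auto
qed

section \<open>Blocks and the position of \<open>y0\<close>\<close>

abbreviation links :: "('v \<times> 'v) set" where
  "links \<equiv> {(fst p, ptgt A p) | p. p \<in> basis A}"

lemma same_block_iff: "same_block A u w \<longleftrightarrow> (u, w) \<in> (links \<union> links\<inverse>)\<^sup>*"
  by (simp add: same_block_def Let_def)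

text \<open>The coefficients at the pairs of an arrow with itself come from trivial paths and form a
  coboundary: \<open>c\<close> is a potential on the vertices of \<open>B\<close>.\<close>

lemma im0_B_diagonal:
  assumes "x \<in> IB"
  shows "\<exists>c. \<forall>a\<in>Es A. rep B x a [a] = c (gl u w (sr A a)) - c (gl u w (tg A a))"
proof -
  let ?Q = "\<lambda>x c. \<forall>a\<in>Es A. rep B x a [a] = c (gl u w (sr A a)) - (c (gl u w (tg A a)) :: 'k)"
  have "fn.subspace {x. \<exists>c. ?Q x c}"
  proof (rule fn.subspaceI)
    have "?Q 0 (\<lambda>_. 0)" by simp
    then show "0 \<in> {x. \<exists>c. ?Q x c}" by (intro CollectI exI)
  next
    fix x y assume "x \<in> {x. \<exists>c. ?Q x c}" "y \<in> {x. \<exists>c. ?Q x c}"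
    then obtain c d where "?Q x c" "?Q y d" by (elim CollectE exE)
    then have "?Q (x + y) (\<lambda>v. c v + d v)" by simp
    then show "x + y \<in> {x. \<exists>c. ?Q x c}" by (intro CollectI exI)
  next
    fix k x assume "x \<in> {x. \<exists>c. ?Q x c}"
    then obtain c where "?Q x c" by (elim CollectE exE)
    then have "?Q (scal k x) (\<lambda>v. k * c v)" by (simp add: right_diff_distrib)
    then show "scal k x \<in> {x. \<exists>c. ?Q x c}" by (intro CollectI exI)
  qed
  moreover have "inner B v c \<in> {x. \<exists>c. ?Q x c}" if v: "v \<in> Vs B" and c: "ok B c" "walk B v c v" for v c
  proof -
    \<comment> \<open>A trivial path has the indicator of its vertex as potential, a longer cycle
      the potential 0.\<close>
    have "?Q (inner B v c) (\<lambda>x. if c = [] \<and> x = v then 1 else 0)"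
      by (auto simp: B.rep_d0b[OF v c] inn_triv B.ok_single)
    then show ?thesis by (intro CollectI exI)
  qed
  ultimately have "IB \<subseteq> {x. \<exists>c. ?Q x c}" by (rule B.im0_subset)
  then show ?thesis using assms by blast
qed

lemma y0_notin:
  assumes "same_block A u w"
  shows "y0 \<notin> IB"
proof
  assume "y0 \<in> IB"
  then obtain c where c: "\<forall>a\<in>Es A. rep B y0 a [a] = c (gl u w (sr A a)) - c (gl u w (tg A a))"
    using im0_B_diagonal by blast
  \<comment> \<open>The potential of \<open>y0\<close> on \<open>A\<close>, the indicator of
    \<open>u\<close>, minus the one pulled back from \<open>B\<close>. The difference is constant
    along arrows, hence on blocks, while its two parts force values at \<open>u\<close> and
    \<open>w\<close> that differ by 1.\<close>
  define f where "f v = (if v = u then 1 else 0) - c (gl u w v)" for v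
  have f: "f (sr A a) = f (tg A a)" if a: "a \<in> Es A" for a
  proof -
    have "rep B y0 a [a] = (if sr A a = u then 1 else 0) - (if tg A a = u then 1 else 0)"
      using uV ok_Nil a by (subst psi_d0b) (auto simp: inn_triv ok_single)
    then show ?thesis
      using c a
      by (auto simp: f_def algebra_simps split: if_split_asm)
  qed
  have walk: "f s = f t" if "walk A s g t" "set g \<subseteq> Es A" for s g t
    using that f by (induction g arbitrary: s) auto
  have "f x = f y" if "(x, y) \<in> links" for x y
    using that walk by (auto simp: walk_iff basis_def paths_def)
  then have link: "f x = f y" if "(x, y) \<in> links \<union> links\<inverse>" for x y using that by fastforce
  have "f u = f y" if "(u, y) \<in> (links \<union> links\<inverse>)\<^sup>*" for y
    using that
  proof (induction rule: rtrancl_induct)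
    case (step y z)
    then show ?case using link[of y z] by simp
  qed simp
  then have "f u = f w" using assms by (simp only: same_block_iff)
  then show False using uw by (simp add: f_def)
qed

text \<open>The idempotents of a block sum to a central element, so their inner derivations add up
  to 0. In the block of \<open>u\<close> every other vertex differs from \<open>w\<close>, and its
  inner derivation is mapped to one of \<open>B\<close>.\<close>

lemma y0_in:
  assumes nb: "\<not> same_block A u w"
  shows "y0 \<in> IB"
proof -
  define C where "C = {v \<in> Vs A. (u, v) \<in> (links \<union> links\<inverse>)\<^sup>*}"
  have uC: "u \<in> C" using uV by (simp add: C_def)
  have wC: "w \<notin> C" using nb by (simp add: C_def same_block_iff)
  have finC: "finite C" using finite_V by (simp add: C_def)
  have closed: "sr A a \<in> C \<longleftrightarrow> tg A a \<in> C" if a: "a \<in> Es A" for a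
  proof -
    have "(sr A a, [a]) \<in> basis A \<and> ptgt A (sr A a, [a]) = tg A a"
      unfolding basis_ptgt_iff using a quiver(1) ok_single by simp
    then have "(sr A a, tg A a) \<in> links" by force
    then have 1: "(sr A a, tg A a) \<in> links \<union> links\<inverse>"
      and 2: "(tg A a, sr A a) \<in> links \<union> links\<inverse>" by blast+
    have "(u, sr A a) \<in> (links \<union> links\<inverse>)\<^sup>* \<longleftrightarrow> (u, tg A a) \<in> (links \<union> links\<inverse>)\<^sup>*"
      using rtrancl.rtrancl_into_rtrancl[OF _ 1, of u] rtrancl.rtrancl_into_rtrancl[OF _ 2, of u]
      by (rule iffI)
    then show ?thesis by (simp only: C_def mem_Collect_eq quiver[OF a])
  qed
  have "(\<Sum>v\<in>C. inner A v []) = 0"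
  proof (rule rep_eqI)
    have V: "v \<in> Vs A" if "v \<in> C" for v using that by (simp add: C_def)
    show "(\<Sum>v\<in>C. inner A v []) \<in> fspace (arrow_pairs A)"
      using V ok_Nil by (intro fn.subspace_sum[OF subspace_fspace] d0b_fspace) auto
    fix a g assume a: "a \<in> Es A" and g: "ok A g"
    have "rep A (\<Sum>v\<in>C. inner A v []) a g = (\<Sum>v\<in>C. inn A v [] a g)"
      unfolding rep_sum using V ok_Nil by (intro sum.cong refl rep_d0b) auto
    also have "\<dots> = (\<Sum>v\<in>C. if sr A a = v then if g = [a] then 1 else 0 else 0)
        - (\<Sum>v\<in>C. if tg A a = v then if g = [a] then 1 else 0 else 0)"
      unfolding sum_subtractf[symmetric] using a g by (intro sum.cong) (auto simp: inn_def)
    \<comment> \<open>An arrow has both end points in \<open>C\<close> or neither, so the two sums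
      cancel.\<close>
    also have "\<dots> = 0" using closed[OF a] finC by simp
    finally show "rep A (\<Sum>v\<in>C. inner A v []) a g = rep A 0 a g" by simp
  qed (auto simp: fspace_def)
  then have "0 = psi (\<Sum>v\<in>C. inner A v [])" by (simp add: module_hom.zero[OF psi_linear])
  also have "\<dots> = (\<Sum>v\<in>C. psi (inner A v []))" by (rule module_hom.sum[OF psi_linear])
  also have "\<dots> = y0 + (\<Sum>v\<in>C - {u}. psi (inner A v []))"
    using uC finC by (simp add: sum.remove)
  finally have "y0 = - (\<Sum>v\<in>C - {u}. psi (inner A v []))"
    by (simp add: eq_neg_iff_add_eq_0)
  moreover have "(\<Sum>v\<in>C - {u}. psi (inner A v [])) \<in> IB"
  proof (rule fn.subspace_sum[OF B.subspace_im0])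
    fix v assume "v \<in> C - {u}"
    then have v: "v \<in> Vs A" "v \<noteq> u" "v \<noteq> w" using wC by (auto simp: C_def)
    then have "v \<in> Vs B" by (force simp: gl_def)
    then have "inner B v [] \<in> IB" using B.ok_Nil by (intro B.d0b_im0) auto
    then show "psi (inner A v []) \<in> IB" using psi_inner_vertex[OF v] by simp
  qed
  ultimately show ?thesis using fn.subspace_neg[OF B.subspace_im0] by simp
qed

lemma Y_eq_im0:
  assumes "\<not> same_block A u w"
  shows "D.Y = IB"
proof
  show "D.Y \<subseteq> IB"
  proof
    fix z assume "z \<in> D.Y"
    then obtain k where "z - scal k y0 \<in> IB" using Y_codim by blast
    moreover have "scal k y0 \<in> IB"
      by (intro fn.subspace_scale[OF B.subspace_im0] y0_in assms)
    ultimately have "(z - scal k y0) + scal k y0 \<in> IB" by (rule fn.subspace_add[OF B.subspace_im0])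
    then show "z \<in> IB" by (simp only: diff_add_cancel)
  qed
qed (rule im0_B_Y)

text \<open>Now \<open>x\<close> and \<open>y\<close> differ from elements \<open>psi a\<close> and
  \<open>psi b\<close> by elements of the ideal \<open>IB\<close>, which lies in \<open>Y\<close>.
  The bracket of the latter two is \<open>psi\<close> of a bracket of \<open>a\<close> with an
  element of the ideal \<open>IA\<close>.\<close>

lemma Y_ideal:
  assumes eq: "ZSS = ZS" and x: "x \<in> KB" and y: "y \<in> D.Y"
  shows "lbr B x y \<in> D.Y"
proof -
  obtain a z where a: "a \<in> KA" "z \<in> ZS" "x = psi a + z"
    using D.decomp[OF x] unfolding eq by blast
  obtain b z' where b: "b \<in> IA" "z' \<in> ZS" "y = psi b + z'" using y by (rule D.YE)
  have bK: "b \<in> KA" using b(1) im0_ker1 by blast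
  have V: "a \<in> fspace (arrow_pairs A)" "b \<in> fspace (arrow_pairs A)"
    using a(1) bK by (auto simp: ker1_def)
  have "lbr B x z' \<in> D.Y"
    using B.im0_ideal[OF x] b(2) Zsp_im0 im0_B_Y by blast
  moreover have "lbr B (psi b) z \<in> D.Y"
    using B.im0_ideal[OF psi_ker1[OF bK]] a(2) Zsp_im0 im0_B_Y by blast
  moreover have "lbr B (psi b) (psi a) \<in> D.Y"
  proof -
    have "lbr A b a \<in> IA"
      using im0_ideal[OF a(1) b(1)] fn.subspace_neg[OF subspace_im0] by (simp only: lbr_commute[of b a])
    then show ?thesis using D.psi_Y psi_lbr[OF V(2,1)] by metis
  qed
  moreover have "lbr B x y = lbr B x z' - (lbr B (psi b) (psi a) + lbr B (psi b) z)"
  proof -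
    have "lbr B x y = lbr B x (psi b) + lbr B x z'"
      unfolding b(3) by (rule module_hom.add[OF B.lbr_linear])
    also have "lbr B x (psi b) = - lbr B (psi b) x" by (rule B.lbr_commute)
    also have "lbr B (psi b) x = lbr B (psi b) (psi a) + lbr B (psi b) z"
      unfolding a(3) by (rule module_hom.add[OF B.lbr_linear])
    finally show ?thesis by (simp only: minus_add_distrib diff_conv_add_uminus ac_simps)
  qed
  ultimately show ?thesis
    using fn.subspace_add[OF D.subspace_Y] fn.subspace_diff[OF D.subspace_Y] by metis
qed

section \<open>Homomorphisms between the quotient Lie algebras\<close>

abbreviation theta where "theta \<equiv> induced IB D.Y id"

lemma theta_coset: "theta (coset IB x) = coset D.Y x"
  using im0_B_Y
  by (subst induced_coset[OF _ B.subspace_im0 D.subspace_Y]) (auto intro: flinearI)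

lemma pi0_eq: "pi0 A u w = pi1 A u w"
  by (simp add: pi0_def pi1_def fun_eq_iff)

lemma qbr_IB: "x \<in> KB \<Longrightarrow> z \<in> KB \<Longrightarrow> qbr (lbr B) IB (coset IB x) (coset IB z) = coset IB (lbr B x z)"
  by (rule qbr_coset[OF B.subspace_im0 B.im0_ker1 B.subspace_ker1 B.lbr_linear B.lbr_commute
        B.im0_ideal])

lemma qbr_IA: "x \<in> KA \<Longrightarrow> z \<in> KA \<Longrightarrow> qbr (lbr A) IA (coset IA x) (coset IA z) = coset IA (lbr A x z)"
  by (rule qbr_coset[OF subspace_im0 im0_ker1 subspace_ker1 lbr_linear lbr_commute im0_ideal])

lemma qbr_Y:
  "ZSS = ZS \<Longrightarrow> x \<in> KB \<Longrightarrow> z \<in> KB \<Longrightarrow>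
    qbr (lbr B) D.Y (coset D.Y x) (coset D.Y z) = coset D.Y (lbr B x z)"
  by (rule qbr_coset[OF D.subspace_Y D.Y_KB B.subspace_ker1 B.lbr_linear B.lbr_commute Y_ideal])

lemma theta_hom:
  assumes "X \<in> quot KB IB" "Z \<in> quot KB IB"
  shows "theta (qadd X Z) = qadd (theta X) (theta Z)"
    and "theta (qscale IB c X) = qscale D.Y c (theta X)"
    and "ZSS = ZS \<Longrightarrow> theta (qbr (lbr B) IB X Z) = qbr (lbr B) D.Y (theta X) (theta Z)"
  using assms
  by (auto simp: quot_def qadd_coset[OF B.subspace_im0] qadd_coset[OF D.subspace_Y]
      qscale_coset[OF B.subspace_im0] qscale_coset[OF D.subspace_Y] qbr_IB qbr_Y theta_coset)

lemma phi_qbr: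
  assumes eq: "ZSS = ZS" and "X \<in> quot KA IA" "Z \<in> quot KA IA"
  shows "D.phi (qbr (lbr A) IA X Z) = qbr (lbr B) D.Y (D.phi X) (D.phi Z)"
proof -
  obtain x z where x: "x \<in> KA" "X = coset IA x" and z: "z \<in> KA" "Z = coset IA z"
    using assms by (auto simp: quot_def)
  have "psi (lbr A x z) = lbr B (psi x) (psi z)"
    using x z by (intro psi_lbr) (simp_all add: ker1_def)
  then show ?thesis
    using x z by (simp add: qbr_IA D.phi_coset qbr_Y[OF eq psi_ker1 psi_ker1])
qed

lemma theta_image: "theta ` quot KB IB = quot KB D.Y"
  unfolding quot_def image_image theta_coset ..

lemma theta_kernel: "{X \<in> quot KB IB. theta X = D.Y} = quot D.Y IB"
proof (intro equalityI subsetI)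
  fix X assume "X \<in> {X \<in> quot KB IB. theta X = D.Y}"
  then obtain x where "X = coset IB x" "theta X = D.Y" by (auto simp: quot_def)
  then show "X \<in> quot D.Y IB"
    by (auto simp: theta_coset coset_eq_self_iff[OF D.subspace_Y] quot_def)
next
  fix X assume "X \<in> quot D.Y IB"
  then obtain x where "X = coset IB x" "x \<in> D.Y" by (auto simp: quot_def)
  then show "X \<in> {X \<in> quot KB IB. theta X = D.Y}"
    using D.Y_KB by (auto simp: theta_coset coset_eq_self_iff[OF D.subspace_Y] quot_def)
qed

text \<open>Dimension 1 is expressed by a nonzero coset whose multiples exhaust the quotient; the
  class of \<open>y0\<close> serves.\<close>

lemma quot_Y_line:
  assumes "same_block A u w"
  shows "\<exists>X\<in>quot D.Y IB. X \<noteq> IB \<and> quot D.Y IB = {qscale IB c X | c. True}"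
proof (intro bexI[of _ "coset IB y0"] conjI)
  show "coset IB y0 \<noteq> IB"
    using y0_notin[OF assms] by (simp add: coset_eq_self_iff[OF B.subspace_im0])
  show "coset IB y0 \<in> quot D.Y IB" unfolding quot_def by (rule imageI[OF y0_Y])
  show "quot D.Y IB = {qscale IB c (coset IB y0) | c. True}"
    unfolding qscale_coset[OF B.subspace_im0]
  proof (intro equalityI subsetI)
    fix X assume "X \<in> quot D.Y IB"
    then obtain z where z: "z \<in> D.Y" "X = coset IB z" by (auto simp: quot_def)
    then obtain k where "z - scal k y0 \<in> IB" using Y_codim by blast
    then have "X = coset IB (scal k y0)" by (simp add: z(2) coset_eq_iff[OF B.subspace_im0])
    then show "X \<in> {coset IB (scal c y0) | c. True}" by (intro CollectI exI conjI TrueI)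
  next
    fix X assume "X \<in> {coset IB (scal c y0) | c. True}"
    then obtain c where "X = coset IB (scal c y0)" by (elim CollectE exE conjE)
    then show "X \<in> quot D.Y IB"
      unfolding quot_def by (simp add: fn.subspace_scale[OF D.subspace_Y y0_Y])
  qed
qed

end

theorem theorem3p21:
  fixes A :: "('v,'a) mon" and u w :: 'v
    and KA KB IA IB Y ZS ZSS :: "(('v,'a) ppair \<Rightarrow> 'k::field) set"
  assumes finV: "finite (Vs A)" and finE: "finite (Es A)"
    and quiv: "\<forall>a\<in>Es A. sr A a \<in> Vs A \<and> tg A a \<in> Vs A"
    and finZ: "finite (Zs A)"
    and Zpaths: "\<forall>r\<in>Zs A. 2 \<le> length r \<and> (sr A (hd r), r) \<in> paths A"
    and Zmin: "\<forall>r\<in>Zs A. \<forall>r'\<in>Zs A. sublist r r' \<longrightarrow> r = r'"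
    and findim: "finite (basis A)"
    and uV: "u \<in> Vs A" and wV: "w \<in> Vs A" and uw: "u \<noteq> w"
    and u_nonisol: "\<exists>a\<in>Es A. sr A a = u \<or> tg A a = u"
    and w_nonisol: "\<exists>a\<in>Es A. sr A a = w \<or> tg A a = w"
    and char: "\<forall>a\<in>Es A. \<forall>m. 2 \<le> m \<and> sr A a = tg A a \<and> sr A a \<in> {u, w}
                  \<and> replicate m a \<in> Zs A \<longrightarrow> of_nat m \<noteq> (0::'k)"
  defines "B \<equiv> glue A u w"
    and "KA \<equiv> ker1 A" and "KB \<equiv> ker1 (glue A u w)" and "IA \<equiv> im0 A" and "IB \<equiv> im0 (glue A u w)"
    and "Y \<equiv> Yspace A u w" and "ZS \<equiv> Zsp A u w" and "ZSS \<equiv> Zspp A u w"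
    and "psi \<equiv> psi1 A u w" and "p0 \<equiv> pi0 A u w" and "p1 \<equiv> pi1 A u w"
    and "phi \<equiv> induced (im0 A) (Yspace A u w) (psi1 A u w)"
    and "piq \<equiv> induced (Yspace A u w) (Zsp A u w) (pi1 A u w)"
    and "theta \<equiv> induced (im0 (glue A u w)) (Yspace A u w) id"
  shows "fsubsp Y \<and> Y \<subseteq> KB
    \<and> ses ZS ZSS (quot ZSS ZS) id (coset ZS) ZS
    \<and> ses Y KB (quot KB Y) id (coset Y) Y
    \<and> ses IA KA (quot KA IA) id (coset IA) IA
    \<and> ses IA Y ZS psi p0 (\<lambda>_. 0)
    \<and> ses KA KB ZSS psi p1 (\<lambda>_. 0)
    \<and> ses (quot KA IA) (quot KB Y) (quot ZSS ZS) phi piq ZS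
    \<and> (\<forall>x\<in>IA. psi (id x) = id (psi x))
    \<and> (\<forall>x\<in>KA. phi (coset IA x) = coset Y (psi x))
    \<and> (\<forall>y\<in>Y. p1 (id y) = id (p0 y))
    \<and> (\<forall>y\<in>KB. piq (coset Y y) = coset ZS (p1 y))
    \<and> (\<not> same_block A u w \<longrightarrow> Y = IB)
    \<and> (same_block A u w \<longrightarrow>
         IB \<subseteq> Y \<and> (\<exists>y\<in>Y. y \<notin> IB \<and> (\<forall>z\<in>Y. \<exists>c. (\<lambda>q. z q - c * y q) \<in> IB)))
    \<and> (ZSS = ZS \<longrightarrow>
         (\<forall>x\<in>KB. \<forall>y\<in>Y. lbr B x y \<in> Y)
       \<and> (\<forall>x\<in>KB. theta (coset IB x) = coset Y x)
       \<and> theta ` quot KB IB = quot KB Y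
       \<and> (\<forall>X\<in>quot KB IB. \<forall>Z\<in>quot KB IB. theta (qadd X Z) = qadd (theta X) (theta Z)
            \<and> theta (qbr (lbr B) IB X Z) = qbr (lbr B) Y (theta X) (theta Z))
       \<and> (\<forall>c. \<forall>X\<in>quot KB IB. theta (qscale IB c X) = qscale Y c (theta X))
       \<and> {X \<in> quot KB IB. theta X = Y} = quot Y IB
       \<and> bij_betw phi (quot KA IA) (quot KB Y)
       \<and> (\<forall>X\<in>quot KA IA. \<forall>Z\<in>quot KA IA. phi (qadd X Z) = qadd (phi X) (phi Z)
            \<and> phi (qbr (lbr A) IA X Z) = qbr (lbr B) Y (phi X) (phi Z))
       \<and> (\<forall>c. \<forall>X\<in>quot KA IA. phi (qscale IA c X) = qscale Y c (phi X))
       \<and> (\<not> same_block A u w \<longrightarrow> quot Y IB = {IB})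
       \<and> (same_block A u w \<longrightarrow>
            (\<exists>X\<in>quot Y IB. X \<noteq> IB \<and> quot Y IB = {qscale IB c X | c. True})))"
proof -
  interpret G: gluing A u w "TYPE('k)"
  proof unfold_locales
    show "walk A (sr A (hd r)) r (tg A (last r))" if "r \<in> Zs A" for r
      using Zpaths that by (fastforce simp: paths_def walk_iff ptgt_def)
    show "set r \<subseteq> Es A" if "r \<in> Zs A" for r
      using Zpaths that by (auto simp: paths_def)
  qed (use assms in auto)
  note defs = B_def KA_def KB_def IA_def IB_def Y_def ZS_def ZSS_def psi_def p0_def p1_def
    phi_def piq_def theta_def
  show ?thesis
    unfolding defs G.Yspace_eq G.pi0_eq fsubsp_iff
  proof (intro conjI impI ballI allI)
    show "fn.subspace G.D.Y" by (rule G.D.subspace_Y)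
    show "G.D.Y \<subseteq> G.KB" by (rule G.D.Y_KB)
    show "ses G.ZS G.ZSS (quot G.ZSS G.ZS) id (coset G.ZS) G.ZS"
      by (rule ses_quot[OF G.subspace_Zsp G.Zsp_Zspp])
    show "ses G.D.Y G.KB (quot G.KB G.D.Y) id (coset G.D.Y) G.D.Y"
      by (rule ses_quot[OF G.D.subspace_Y G.D.Y_KB])
    show "ses G.IA G.KA (quot G.KA G.IA) id (coset G.IA) G.IA"
      by (rule ses_quot[OF G.subspace_im0 G.im0_ker1])
    show "ses G.IA G.D.Y G.ZS G.psi (pi1 A u w) (\<lambda>_. 0)"
      by (rule G.D.ses_Y[unfolded zero_fun_def])
    show "ses G.KA G.KB G.ZSS G.psi (pi1 A u w) (\<lambda>_. 0)"
      by (rule G.D.ses_KB[unfolded zero_fun_def])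
    show "ses (quot G.KA G.IA) (quot G.KB G.D.Y) (quot G.ZSS G.ZS) G.D.phi G.D.piq G.ZS"
      by (rule G.D.ses_quotients)
    show "G.D.phi (coset G.IA x) = coset G.D.Y (G.psi x)" for x by (rule G.D.phi_coset)
    show "G.D.piq (coset G.D.Y y) = coset G.ZS (pi1 A u w y)" for y by (rule G.D.piq_coset)
    show "G.D.Y = G.IB" if "\<not> same_block A u w" by (rule G.Y_eq_im0[OF that])
    show "G.IB \<subseteq> G.D.Y" by (rule G.im0_B_Y)
    show "\<exists>y\<in>G.D.Y. y \<notin> G.IB \<and> (\<forall>z\<in>G.D.Y. \<exists>c. (\<lambda>q. z q - c * y q) \<in> G.IB)"
      if "same_block A u w"
      using G.y0_Y G.y0_notin[OF that] G.Y_codim unfolding fun_diff_def scal_def by blast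
    show "lbr (glue A u w) x y \<in> G.D.Y" if "G.ZSS = G.ZS" "x \<in> G.KB" "y \<in> G.D.Y" for x y
      by (rule G.Y_ideal[OF that])
    show "G.theta (coset G.IB x) = coset G.D.Y x" for x by (rule G.theta_coset)
    show "G.theta ` quot G.KB G.IB = quot G.KB G.D.Y" by (rule G.theta_image)
    show "{X \<in> quot G.KB G.IB. G.theta X = G.D.Y} = quot G.D.Y G.IB" by (rule G.theta_kernel)
    show "bij_betw G.D.phi (quot G.KA G.IA) (quot G.KB G.D.Y)" if "G.ZSS = G.ZS"
      by (rule G.D.bij_phi[OF that])
    show "quot G.D.Y G.IB = {G.IB}" if "\<not> same_block A u w"
      unfolding G.Y_eq_im0[OF that] by (rule quot_self[OF G.B.subspace_im0])
    show "\<exists>X\<in>quot G.D.Y G.IB. X \<noteq> G.IB \<and> quot G.D.Y G.IB = {qscale G.IB c X | c. True}"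
      if "same_block A u w"
      by (rule G.quot_Y_line[OF that])
  \<comment> \<open>What remains are the squares with identity maps and the compatibility of
    \<open>theta\<close> and \<open>phi\<close> with the operations.\<close>
  qed (simp_all only: G.theta_hom G.D.phi_qadd G.D.phi_qscale G.phi_qbr id_apply)
qed

end
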